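(* Let $\Omega\subset\mathbb{C}^n$ be a Reinhardt domain such that the origin is a boundary point of $\Omega$. Then there is an open neighborhood $U$ of the origin in $\mathbb{C}^n$ (depending only on $\Omega$) such that each function in $\mathcal{C}^\infty(\overline{\Omega})\cap\mathcal{O}(\Omega)$ extends holomorphically to $U$; that is, for every $f\in\mathcal{C}^\infty(\overline{\Omega})\cap\mathcal{O}(\Omega)$ there is a holomorphic function $F$ on $\Omega\cup U$ with $F|_\Omega=f$.
   Context: A domain in $\mathbb{C}^n$ is a nonempty connected open set. A domain $\Omega\subset\mathbb{C}^n$ is Reinhardt if $(e^{i\theta_1}z_1,\dots,e^{i\theta_n}z_n)\in\Omega$ whenever $(z_1,\dots,z_n)\in\Omega$ and $\theta_1,\dots,\theta_n\in\mathbb{R}$. For a domain $\Omega\subset\mathbb{C}^n$, $\mathcal{O}(\Omega)$ is the space of holomorphic functions on $\Omega$, and $\mathcal{C}^\infty(\overline{\Omega})$ is the space of those smooth (complex-valued) functions on $\Omega$ whose partial derivatives of all orders extend continuously to the closure $\overline{\Omega}$ of $\Omega$ in $\mathbb{C}^n$. The domain $\Omega$ is not assumed to be bounded or pseudoconvex. *)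

theory Defs
  imports "HOL-Analysis.Analysis"
begin

definition complex_domain :: "(complex ^ 'n) set \<Rightarrow> bool" where
  "complex_domain \<Omega> \<longleftrightarrow> \<Omega> \<noteq> {} \<and> connected \<Omega> \<and> open \<Omega>"

definition Reinhardt_domain :: "(complex ^ 'n) set \<Rightarrow> bool" where
  "Reinhardt_domain \<Omega> \<longleftrightarrow>
     complex_domain \<Omega> \<and> (\<forall>z\<in>\<Omega>. \<forall>\<theta> :: 'n \<Rightarrow> real. (\<chi> i. exp (\<i> * complex_of_real (\<theta> i)) * z $ i) \<in> \<Omega>)"

(* Holomorphy in several variables: a complex-linear Frechet derivative at every point.
   Only meant for open S. *)
definition holomorphic_several_on :: "(complex ^ 'n \<Rightarrow> complex) \<Rightarrow> (complex ^ 'n) set \<Rightarrow> bool" where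
  "holomorphic_several_on f S \<longleftrightarrow>
     (\<forall>z\<in>S. \<exists>D. (f has_derivative D) (at z) \<and> (\<forall>c v. D (c *s v) = c * D v))"

definition partial_deriv ::
    "complex ^ 'n \<Rightarrow> (complex ^ 'n \<Rightarrow> complex) \<Rightarrow> complex ^ 'n \<Rightarrow> complex" where
  "partial_deriv b f z = vector_derivative (\<lambda>t. f (z + t *\<^sub>R b)) (at 0)"

(* iterated_partial [b1, ..., bk] f differentiates along bk first and b1 last. *)
primrec iterated_partial ::
    "(complex ^ 'n) list \<Rightarrow> (complex ^ 'n \<Rightarrow> complex) \<Rightarrow> complex ^ 'n \<Rightarrow> complex" where
  "iterated_partial [] f = f"
| "iterated_partial (b # bs) f = partial_deriv b (iterated_partial bs f)"

(* Basis :: (complex ^ 'n) set consists of the vectors axis j 1 and axis j \<i>, so these are all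
   iterated partial derivatives in the 2n real coordinates Re z_j, Im z_j.
   The case bs = [] covers f itself. Only meant for open S. *)
definition smooth_on :: "(complex ^ 'n) set \<Rightarrow> (complex ^ 'n \<Rightarrow> complex) \<Rightarrow> bool" where
  "smooth_on S f \<longleftrightarrow>
     (\<forall>bs \<in> lists Basis.
        continuous_on S (iterated_partial bs f) \<and>
        (\<forall>b\<in>Basis. \<forall>z\<in>S. (\<lambda>t. iterated_partial bs f (z + t *\<^sub>R b)) differentiable (at 0)))"

definition smooth_up_to_boundary :: "(complex ^ 'n) set \<Rightarrow> (complex ^ 'n \<Rightarrow> complex) \<Rightarrow> bool" where
  "smooth_up_to_boundary \<Omega> f \<longleftrightarrow>
     smooth_on \<Omega> f \<and>
     (\<forall>bs \<in> lists Basis. \<exists>g. continuous_on (closure \<Omega>) g \<and> (\<forall>z\<in>\<Omega>. g z = iterated_partial bs f z))"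

end

theory Submission
  imports Defs "HOL-Complex_Analysis.Cauchy_Integral_Formula"
begin

text \<open>
  The proof expands a function \<open>f\<close> that is holomorphic on the Reinhardt domain \<open>\<Omega>\<close> and smooth up to the
  boundary into its Laurent series and shows that only nonnegative exponents occur.
  
  The Laurent coefficient with exponent \<open>\<alpha> \<in> \<int>\<^sup>n\<close> is the average of \<open>f w * w\<^sup>-\<^sup>\<alpha>\<close> over the torus orbit of a
  point \<open>z \<in> \<Omega>\<close> off the coordinate hyperplanes. It does not depend on \<open>z\<close>
  (\<open>coeff_at_constant_holomorphic\<close>): its partial derivatives in \<open>z\<close> are torus averages of angular
  derivatives of periodic functions, hence zero, and removing the coordinate hyperplanes does not
  disconnect \<open>\<Omega>\<close>.
  
  Negative exponents are excluded by the behaviour at the origin (\<open>negative_coeff_eq_0\<close>). Differentiating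
  \<open>f\<close> exactly \<open>\<alpha>\<^sub>k\<close> times in every variable with \<open>\<alpha>\<^sub>k > 0\<close> multiplies the \<open>\<alpha>\<close>-th coefficient by a
  nonzero factor and replaces \<open>\<alpha>\<close> by \<open>min \<alpha> 0\<close>. The derivative is bounded near \<open>0\<close> because it extends
  continuously to \<open>0 \<in> closure \<Omega>\<close>, so the coefficient is bounded by a constant times \<open>\<bar>z\<^sup>\<beta>\<bar>\<close> with
  \<open>\<beta> = - min \<alpha> 0\<close>. If some \<open>\<alpha>\<^sub>j\<close> is negative, this tends to \<open>0\<close> as \<open>z\<close> tends to \<open>0\<close> within \<open>\<Omega>\<close>.
  
  Now fix \<open>r \<in> \<Omega>\<close> off the coordinate hyperplanes. The Cauchy integral of \<open>f\<close> over the torus orbit of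
  \<open>r\<close> is holomorphic on the polydisc with polyradius \<open>\<bar>r\<^sub>k\<bar>\<close> (\<open>cauchy_extension_holomorphic\<close>), and its
  Taylor coefficients are the Laurent coefficients of \<open>f\<close> (\<open>taylor_partial_sum_bound\<close>). On the orbit of
  any further point of \<open>\<Omega>\<close> inside this polydisc, \<open>f\<close> and the Cauchy integral therefore have the same
  Fourier coefficients, and so they agree (\<open>fourier_uniqueness\<close>, \<open>cauchy_extension_eq\<close>). Comparing Fourier
  coefficients rather than germs is what makes the argument work although the intersection of \<open>\<Omega>\<close>
  with the polydisc need not be connected. The polydisc depends on \<open>\<Omega>\<close> only and serves as \<open>U\<close>.
\<close>

section \<open>Averages of periodic derivatives over the unit cube\<close>

lemma inner_One_Basis: "(e::'a::euclidean_space) \<in> Basis \<Longrightarrow> One \<bullet> e = 1"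
  by (simp add: inner_sum_left inner_Basis)

text \<open>
  By periodicity, the slab by which the shifted cube sticks out of the unit cube can be moved back to
  the slab that the shift has uncovered.
\<close>

lemma integral_unit_cube_shift:
  fixes g :: "'a::euclidean_space \<Rightarrow> complex"
  assumes e: "e \<in> Basis" and s: "0 \<le> s" "s \<le> 1"
    and cont: "continuous_on UNIV g" and per: "\<And>t. g (t + e) = g t"
  shows "integral (cbox 0 One) (\<lambda>t. g (t + s *\<^sub>R e)) = integral (cbox 0 One) g"
proof -
  have int: "g integrable_on cbox a b" for a b
    by (rule integrable_continuous) (rule continuous_on_subset[OF cont], simp)
  have One: "One \<bullet> i = 1" if "i \<in> Basis" for i :: 'a
    using that by (rule inner_One_Basis)
  have shift: "integral (cbox a b) (\<lambda>t. g (t + c)) = integral (cbox (a + c) (b + c)) g" for a b c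
    using integral_shift_cbox_plus[of a b g c] by (simp add: o_def add.commute)
  note split_simps = min_absorb2 max_absorb2 inner_simps inner_Basis One e s inner_sum_left_Basis
  have low: "cbox 0 One \<inter> {x. x \<bullet> e \<le> s} = cbox 0 (One - e + s *\<^sub>R e)"
    unfolding interval_split[OF e] by (rule arg_cong2[where f=cbox]; rule euclidean_eqI; simp add: split_simps)
  have high: "cbox 0 One \<inter> {x. x \<bullet> e \<ge> s} = cbox (s *\<^sub>R e) One"
    unfolding interval_split[OF e] by (rule arg_cong2[where f=cbox]; rule euclidean_eqI; simp add: split_simps)
  have low': "cbox (0 + s *\<^sub>R e) (One + s *\<^sub>R e) \<inter> {x. x \<bullet> e \<le> 1} = cbox (s *\<^sub>R e) One"
    unfolding interval_split[OF e] by (rule arg_cong2[where f=cbox]; rule euclidean_eqI; simp add: split_simps)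
  have high': "cbox (0 + s *\<^sub>R e) (One + s *\<^sub>R e) \<inter> {x. x \<bullet> e \<ge> 1} = cbox (0 + e) (One - e + s *\<^sub>R e + e)"
    unfolding interval_split[OF e] by (rule arg_cong2[where f=cbox]; rule euclidean_eqI; simp add: split_simps)
  have "integral (cbox 0 One) (\<lambda>t. g (t + s *\<^sub>R e)) = integral (cbox (0 + s *\<^sub>R e) (One + s *\<^sub>R e)) g"
    by (rule shift)
  also have "\<dots> = integral (cbox (s *\<^sub>R e) One) g + integral (cbox (0 + e) (One - e + s *\<^sub>R e + e)) g"
    using integral_split[OF int e, of "0 + s *\<^sub>R e" "One + s *\<^sub>R e" 1] unfolding low' high' .
  also have "integral (cbox (0 + e) (One - e + s *\<^sub>R e + e)) g = integral (cbox 0 (One - e + s *\<^sub>R e)) g"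
    using shift[of 0 "One - e + s *\<^sub>R e" e] by (simp only: per)
  also have "integral (cbox (s *\<^sub>R e) One) g + \<dots> = integral (cbox 0 One) g"
    using integral_split[OF int e, of 0 One s] unfolding low high by simp
  finally show ?thesis .
qed

text \<open>
  The integral of \<open>g\<close> over the cube shifted by \<open>s\<close> along \<open>e\<close> is constant in \<open>s\<close>; differentiating under
  the integral sign at \<open>s = 0\<close> gives the claim. Moving whole slabs avoids splitting off a coordinate of
  the cube by Fubini.
\<close>

lemma integral_periodic_derivative:
  fixes g g' :: "'a::euclidean_space \<Rightarrow> complex"
  assumes e: "e \<in> Basis"
    and cont: "continuous_on UNIV g" and cont': "continuous_on UNIV g'"
    and per: "\<And>t. g (t + e) = g t"
    and der: "\<And>t. ((\<lambda>s. g (t + s *\<^sub>R e)) has_vector_derivative g' t) (at 0)"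
  shows "integral (cbox 0 One) g' = 0"
proof -
  define \<phi> where "\<phi> s = integral (cbox 0 One) (\<lambda>t. g (t + s *\<^sub>R e))" for s
  have der_s: "((\<lambda>s. g (t + s *\<^sub>R e)) has_vector_derivative g' (t + s *\<^sub>R e)) (at s within T)" for t s T
  proof -
    have "((\<lambda>r. g ((t + s *\<^sub>R e) + r *\<^sub>R e)) has_vector_derivative g' (t + s *\<^sub>R e)) (at (s - s))"
      using der[of "t + s *\<^sub>R e"] by simp
    moreover have "((\<lambda>r. r - s) has_vector_derivative 1) (at s)"
      by (auto intro!: derivative_eq_intros)
    ultimately have "(((\<lambda>r. g ((t + s *\<^sub>R e) + r *\<^sub>R e)) \<circ> (\<lambda>r. r - s)) has_vector_derivative 1 *\<^sub>R g' (t + s *\<^sub>R e)) (at s)"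
      by (intro vector_diff_chain_at) 
    then show ?thesis
      by (simp add: o_def algebra_simps has_vector_derivative_at_within)
  qed
  have contg: "continuous_on T (\<lambda>x. g (h x))" if "continuous_on T h" for h :: "'z::topological_space \<Rightarrow> 'a" and T
    using continuous_on_compose2[OF cont that] by auto
  have contg': "continuous_on T (\<lambda>x. g' (h x))" if "continuous_on T h" for h :: "'z::topological_space \<Rightarrow> 'a" and T
    using continuous_on_compose2[OF cont' that] by auto
  have "(\<phi> has_vector_derivative integral (cbox 0 One) (\<lambda>t. g' (t + 0 *\<^sub>R e))) (at 0 within {0..1})"
    unfolding \<phi>_def
    by (rule leibniz_rule_vector_derivative[OF der_s])
       (auto intro!: integrable_continuous contg contg' continuous_intros simp: split_def)
  moreover have "(\<phi> has_vector_derivative 0) (at 0 within {0..1})"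
  proof (rule has_vector_derivative_transform)
    show "((\<lambda>s. \<phi> 0) has_vector_derivative 0) (at 0 within {0..1::real})"
      by (rule has_vector_derivative_const)
    show "\<phi> s = \<phi> 0" if "s \<in> {0..1}" for s
      using integral_unit_cube_shift[OF e _ _ cont per] that by (simp add: \<phi>_def)
  qed simp
  ultimately have "integral (cbox 0 One) (\<lambda>t. g' (t + 0 *\<^sub>R e)) = 0"
    using vector_derivative_unique_within_closed_interval[of 0 1 0 \<phi>] by auto
  then show ?thesis by simp
qed

section \<open>Torus averages and Laurent monomials\<close>

text \<open>
  Angles are measured in full turns, so that the torus is the unit cube of volume \<open>1\<close> with opposite faces
  identified and averages need no normalising factor.
\<close>

definition rot :: "real ^ 'n \<Rightarrow> complex ^ 'n \<Rightarrow> complex ^ 'n" where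
  "rot t z = (\<chi> k. cis (2 * pi * t $ k) * z $ k)"

definition rot_invariant :: "(complex ^ 'n) set \<Rightarrow> bool" where
  "rot_invariant S \<longleftrightarrow> (\<forall>z\<in>S. \<forall>t. rot t z \<in> S)"

definition torus_avg :: "(complex ^ 'n \<Rightarrow> complex) \<Rightarrow> complex ^ 'n \<Rightarrow> complex" where
  "torus_avg h z = integral (cbox 0 One) (\<lambda>t. h (rot t z))"

definition has_partial ::
    "'n \<Rightarrow> (complex ^ 'n \<Rightarrow> complex) \<Rightarrow> (complex ^ 'n \<Rightarrow> complex) \<Rightarrow> (complex ^ 'n) set \<Rightarrow> bool" where
  "has_partial k h h' S \<longleftrightarrow>
     (\<forall>z\<in>S. ((\<lambda>\<zeta>. h (z + axis k \<zeta>)) has_field_derivative h' z) (at 0))"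

definition mon :: "('n \<Rightarrow> int) \<Rightarrow> complex ^ 'n \<Rightarrow> complex" where
  "mon \<alpha> z = (\<Prod>k\<in>UNIV. z $ k powi \<alpha> k)"

definition off_axes :: "(complex ^ 'n) set" where
  "off_axes = {z. \<forall>k. z $ k \<noteq> 0}"

text \<open>
  The \<open>\<alpha>\<close>-th Laurent coefficient of \<open>h\<close>, computed on the torus orbit of a chosen base point. The
  monomial is evaluated at the points of the orbit and not only at the rotation angles; with this
  normalisation the coefficient of a holomorphic function is the same at all base points off the
  coordinate hyperplanes of a rotation-invariant domain.
\<close>

definition coeff_at :: "(complex ^ 'n \<Rightarrow> complex) \<Rightarrow> ('n \<Rightarrow> int) \<Rightarrow> complex ^ 'n \<Rightarrow> complex" where
  "coeff_at h \<alpha> = torus_avg (\<lambda>w. h w * mon (\<lambda>k. - \<alpha> k) w)"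

lemma axis_zero [simp]: "axis k 0 = 0"
  by simp

lemma norm_axis_complex: "norm (axis k \<zeta> :: complex ^ 'n) = norm \<zeta>"
  unfolding norm_eq_sqrt_inner by (simp add: inner_axis_axis)

lemma rot_nth [simp]: "rot t z $ k = cis (2 * pi * t $ k) * z $ k"
  by (simp add: rot_def)

lemma rot_period: "rot (t + axis k 1) z = rot t z"
proof -
  have "cis (x + 2 * pi) = cis x" for x
    by (simp flip: cis_mult)
  then show ?thesis
    by (auto simp: vec_eq_iff axis_def distrib_left)
qed

lemma rot_add_axis:
  "rot (t + s *\<^sub>R axis k 1) z = rot t z + axis k ((cis (2 * pi * s) - 1) * rot t z $ k)"
  by (simp add: vec_eq_iff axis_def distrib_left algebra_simps flip: cis_mult)

lemma continuous_on_rot [continuous_intros]: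
  assumes "continuous_on S f" "continuous_on S g"
  shows "continuous_on S (\<lambda>x. rot (f x) (g x))"
  unfolding rot_def cis_conv_exp using assms by (intro continuous_intros) auto

lemma continuous_on_axis [continuous_intros]:
  fixes f :: "'a::topological_space \<Rightarrow> complex"
  assumes "continuous_on S f"
  shows "continuous_on S (\<lambda>x. axis k (f x) :: complex ^ 'n)"
  unfolding axis_def
proof (rule continuous_on_vec_lambda)
  show "continuous_on S (\<lambda>x. if i = k then f x else 0)" for i
    using assms by (cases "i = k") auto
qed

lemma torus_avg_integrable:
  fixes h :: "complex ^ 'n \<Rightarrow> complex"
  assumes "rot_invariant S" "continuous_on S h" "z \<in> S"
  shows "(\<lambda>t. h (rot t z)) integrable_on cbox a b"
  by (rule integrable_continuous, rule continuous_on_compose2[OF assms(2)])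
     (use assms in \<open>auto simp: rot_invariant_def intro!: continuous_intros\<close>)

text \<open>
  Rotating the \<open>k\<close>-th coordinate shows that \<open>2 * pi * \<i> * w $ k * h' w\<close> is the derivative of \<open>h\<close> in the
  \<open>k\<close>-th angle, and \<open>h\<close> is periodic in that angle. The independence of Laurent coefficients from
  the base point, the orthogonality of monomials and the effect of differentiation on coefficients
  all come from this identity.
\<close>

lemma torus_avg_partial_eq_0:
  assumes S: "rot_invariant S" "z \<in> S"
    and cont: "continuous_on S h" "continuous_on S h'"
    and der: "has_partial k h h' S"
  shows "torus_avg (\<lambda>w. w $ k * h' w) z = 0"
proof -
  have rot_S: "rot t z \<in> S" for t
    using S by (auto simp: rot_invariant_def)
  have "integral (cbox 0 One) (\<lambda>t. (2 * pi * \<i>) * (rot t z $ k * h' (rot t z))) = 0"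
  proof (rule integral_periodic_derivative)
    show "axis k (1::real) \<in> Basis" by simp
    show "continuous_on UNIV (\<lambda>t. h (rot t z))"
      by (rule continuous_on_compose2[OF cont(1)]) (auto intro!: continuous_intros simp: rot_S)
    have "continuous_on UNIV (\<lambda>t. h' (rot t z))"
      by (rule continuous_on_compose2[OF cont(2)]) (auto intro!: continuous_intros simp: rot_S)
    then show "continuous_on UNIV (\<lambda>t. (2 * pi * \<i>) * (rot t z $ k * h' (rot t z)))"
      by (intro continuous_intros)
    show "h (rot (t + axis k 1) z) = h (rot t z)" for t
      by (simp add: rot_period)
    fix t
    define w where "w = rot t z"
    have "((\<lambda>s. (exp (2 * pi * \<i> * of_real s) - 1) * w $ k) has_vector_derivative
             2 * pi * \<i> * w $ k) (at 0)"
      by (rule has_vector_derivative_real_field) (auto intro!: derivative_eq_intros)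
    moreover have "((\<lambda>\<zeta>. h (w + axis k \<zeta>)) has_field_derivative h' w) (at 0)"
      using der rot_S by (auto simp: has_partial_def w_def)
    ultimately have "((\<lambda>\<zeta>. h (w + axis k \<zeta>)) \<circ> (\<lambda>s. (exp (2 * pi * \<i> * of_real s) - 1) * w $ k)
             has_vector_derivative 2 * pi * \<i> * w $ k * h' w) (at 0)"
      by (intro field_vector_diff_chain_at) auto
    then show "((\<lambda>s. h (rot (t + s *\<^sub>R axis k 1) z)) has_vector_derivative
                  (2 * pi * \<i>) * (rot t z $ k * h' (rot t z))) (at 0)"
      unfolding rot_add_axis o_def w_def[symmetric] cis_conv_exp
      by (simp add: mult_ac)
  qed
  then show ?thesis
    by (simp add: torus_avg_def)
qed

text \<open>
  Differentiation under the integral sign: moving the base point by \<open>\<zeta>\<close> in coordinate \<open>k\<close> moves the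
  rotated point by \<open>cis (2 * pi * t $ k) * \<zeta>\<close> in that coordinate.
\<close>

lemma torus_avg_has_derivative:
  fixes h :: "complex ^ 'n \<Rightarrow> complex"
  assumes S: "rot_invariant S" "open S" "z \<in> S"
    and cont: "continuous_on S h" "continuous_on S h'"
    and der: "has_partial k h h' S"
  shows "((\<lambda>\<zeta>. torus_avg h (z + axis k \<zeta>)) has_field_derivative
            integral (cbox 0 One) (\<lambda>t. cis (2 * pi * t $ k) * h' (rot t z))) (at 0)"
proof -
  obtain r where r: "r > 0" "ball z r \<subseteq> S"
    using S open_contains_ball by blast
  have in_S: "z + axis k \<zeta> \<in> S" if "\<zeta> \<in> ball 0 r" for \<zeta>
    using r that by (auto intro!: subsetD[OF r(2)] simp: dist_norm norm_axis_complex)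
  have rot_S: "rot t (z + axis k \<zeta>) \<in> S" if "\<zeta> \<in> ball 0 r" for t \<zeta>
    using S in_S[OF that] by (auto simp: rot_invariant_def)
  have "((\<lambda>\<zeta>. torus_avg h (z + axis k \<zeta>)) has_field_derivative
     integral (cbox 0 One) (\<lambda>t. cis (2 * pi * t $ k) * h' (rot t (z + axis k 0)))) (at 0 within ball 0 r)"
    unfolding torus_avg_def
  proof (rule leibniz_rule_field_derivative)
    fix \<zeta> :: complex and t :: "real ^ 'n" assume \<zeta>: "\<zeta> \<in> ball 0 r"
    define w where "w = rot t (z + axis k \<zeta>)"
    have "((\<lambda>u. h (w + axis k u)) has_field_derivative h' w) (at (cis (2 * pi * t $ k) * (\<zeta> - \<zeta>)))"
      using der rot_S[OF \<zeta>] by (auto simp: has_partial_def w_def)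
    moreover have "((\<lambda>\<xi>. cis (2 * pi * t $ k) * (\<xi> - \<zeta>)) has_field_derivative cis (2 * pi * t $ k)) (at \<zeta>)"
      by (auto intro!: derivative_eq_intros)
    ultimately have "((\<lambda>u. h (w + axis k u)) \<circ> (\<lambda>\<xi>. cis (2 * pi * t $ k) * (\<xi> - \<zeta>)) has_field_derivative
        h' w * cis (2 * pi * t $ k)) (at \<zeta>)"
      by (intro DERIV_chain) auto
    moreover have "rot t (z + axis k \<xi>) = w + axis k (cis (2 * pi * t $ k) * (\<xi> - \<zeta>))" for \<xi>
      by (simp add: w_def vec_eq_iff axis_def algebra_simps)
    ultimately have "((\<lambda>\<xi>. h (rot t (z + axis k \<xi>))) has_field_derivative cis (2 * pi * t $ k) * h' w) (at \<zeta>)"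
      by (simp add: o_def mult.commute)
    then show "((\<lambda>\<xi>. h (rot t (z + axis k \<xi>))) has_field_derivative
        cis (2 * pi * t $ k) * h' (rot t (z + axis k \<zeta>))) (at \<zeta> within ball 0 r)"
      unfolding w_def by (rule has_field_derivative_at_within)
  next
    show "(\<lambda>t. h (rot t (z + axis k \<zeta>))) integrable_on cbox 0 One" if "\<zeta> \<in> ball 0 r" for \<zeta>
      using S cont in_S[OF that] by (intro torus_avg_integrable)
    have "continuous_on (ball 0 r \<times> cbox 0 One) (\<lambda>(\<zeta>, t). h' (rot t (z + axis k \<zeta>)))"
      unfolding split_def
      by (rule continuous_on_compose2[OF cont(2)]) (auto intro!: continuous_intros simp: rot_S)
    then show "continuous_on (ball 0 r \<times> cbox 0 One)
        (\<lambda>(\<zeta>, t). cis (2 * pi * t $ k) * h' (rot t (z + axis k \<zeta>)))"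
      unfolding split_def cis_conv_exp by (intro continuous_intros)
  qed (use r in auto)
  then show ?thesis
    using r by (simp add: at_within_open[of _ "ball 0 r"] axis_def vec_eq_iff zero_vec_def[symmetric])
qed

text \<open>
  Up to the nonzero factor \<open>z $ k\<close>, the derivative of the average with respect to the base point is the
  average of an angular derivative.
\<close>

lemma torus_avg_has_derivative_0:
  assumes "rot_invariant S" "open S" "z \<in> S" "S \<subseteq> off_axes"
    and "continuous_on S h" "continuous_on S h'"
    and "has_partial k h h' S"
  shows "((\<lambda>\<zeta>. torus_avg h (z + axis k \<zeta>)) has_field_derivative 0) (at 0)"
proof -
  have "z $ k \<noteq> 0"
    using assms by (auto simp: off_axes_def)
  moreover have "torus_avg (\<lambda>w. w $ k * h' w) z = z $ k * integral (cbox 0 One) (\<lambda>t. cis (2 * pi * t $ k) * h' (rot t z))"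
    unfolding torus_avg_def by (simp add: mult_ac)
  moreover have "torus_avg (\<lambda>w. w $ k * h' w) z = 0"
    using assms by (intro torus_avg_partial_eq_0)
  ultimately show ?thesis
    using torus_avg_has_derivative[of S z h h' k] assms by simp
qed

lemma mon_mult: "z \<in> off_axes \<Longrightarrow> mon \<alpha> z * mon \<beta> z = mon (\<lambda>k. \<alpha> k + \<beta> k) z"
  by (simp add: mon_def off_axes_def power_int_add flip: prod.distrib)

lemma mon_0 [simp]: "mon (\<lambda>k. 0) z = 1"
  by (simp add: mon_def)

lemma mon_upd: "mon (\<alpha>(k := a)) z = z $ k powi a * (\<Prod>j\<in>-{k}. z $ j powi \<alpha> j)"
  unfolding mon_def by (subst prod.remove[of _ k]) (auto simp: Compl_eq_Diff_UNIV intro!: prod.cong)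

lemma mon_split: "mon \<alpha> z = z $ k powi \<alpha> k * (\<Prod>j\<in>-{k}. z $ j powi \<alpha> j)"
  using mon_upd[of \<alpha> k "\<alpha> k" z] by simp

lemma mon_Suc: "z $ k \<noteq> 0 \<Longrightarrow> mon (\<alpha>(k := \<alpha> k + 1)) z = z $ k * mon \<alpha> z"
  by (simp add: mon_upd mon_split[of \<alpha> z k] power_int_add)

lemma norm_mon_rot [simp]: "norm (mon \<alpha> (rot t z)) = norm (mon \<alpha> z)"
  by (simp add: mon_def norm_power_int norm_mult prod_norm[symmetric])

lemma has_partial_mon:
  fixes \<alpha> :: "'n::finite \<Rightarrow> int"
  shows "has_partial k (mon \<alpha>) (\<lambda>z. of_int (\<alpha> k) * mon \<alpha> z / z $ k) off_axes"
  unfolding has_partial_def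
proof
  fix z :: "complex ^ 'n" assume z: "z \<in> off_axes"
  define C where "C = (\<Prod>j\<in>-{k}. z $ j powi \<alpha> j)"
  have eq: "mon \<alpha> (z + axis k \<zeta>) = (z $ k + \<zeta>) powi \<alpha> k * C" for \<zeta>
    unfolding mon_split[of \<alpha> _ k] C_def by (auto simp: axis_def intro!: arg_cong2[where f="(*)"] prod.cong)
  have "((\<lambda>\<zeta>. (z $ k + \<zeta>) powi \<alpha> k * C) has_field_derivative
          of_int (\<alpha> k) * (z $ k) powi (\<alpha> k - 1) * C) (at 0)"
    using z by (auto intro!: derivative_eq_intros simp: off_axes_def)
  moreover have "of_int (\<alpha> k) * (z $ k) powi (\<alpha> k - 1) * C = of_int (\<alpha> k) * mon \<alpha> z / z $ k"
    using z unfolding mon_split[of \<alpha> _ k] C_def by (simp add: power_int_diff off_axes_def)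
  ultimately show "((\<lambda>\<zeta>. mon \<alpha> (z + axis k \<zeta>)) has_field_derivative
      of_int (\<alpha> k) * mon \<alpha> z / z $ k) (at 0)"
    unfolding eq by simp
qed

lemma has_partial_mult:
  assumes "has_partial k f f' S" "has_partial k g g' S"
  shows "has_partial k (\<lambda>z. f z * g z) (\<lambda>z. f' z * g z + f z * g' z) S"
  using assms unfolding has_partial_def
  by (auto intro!: derivative_eq_intros simp: mult.commute)

lemma has_partial_subset: "has_partial k f f' S \<Longrightarrow> T \<subseteq> S \<Longrightarrow> has_partial k f f' T"
  by (auto simp: has_partial_def)

lemma continuous_on_mon [continuous_intros]: "continuous_on off_axes (mon \<alpha>)"
  unfolding mon_def by (intro continuous_intros) (auto simp: off_axes_def)

lemma rot_invariant_off_axes: "rot_invariant off_axes"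
  by (auto simp: rot_invariant_def off_axes_def)

text \<open>
  If \<open>\<alpha> k \<noteq> 0\<close>, the monomial is a multiple of its own derivative in the \<open>k\<close>-th angle.
\<close>

lemma torus_avg_mon:
  assumes "z \<in> off_axes"
  shows "torus_avg (mon \<alpha>) z = (if \<alpha> = (\<lambda>k. 0) then 1 else 0)"
proof (cases "\<alpha> = (\<lambda>k. 0)")
  case True
  then show ?thesis by (simp add: torus_avg_def)
next
  case False
  then obtain k where k: "\<alpha> k \<noteq> 0" by auto
  have "torus_avg (\<lambda>w. w $ k * (of_int (\<alpha> k) * mon \<alpha> w / w $ k)) z = 0"
    by (rule torus_avg_partial_eq_0[OF rot_invariant_off_axes assms _ _ has_partial_mon])
       (auto intro!: continuous_intros simp: off_axes_def[symmetric], auto simp: off_axes_def)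
  also have "torus_avg (\<lambda>w. w $ k * (of_int (\<alpha> k) * mon \<alpha> w / w $ k)) z = of_int (\<alpha> k) * torus_avg (mon \<alpha>) z"
    using assms by (simp add: torus_avg_def off_axes_def)
  finally show ?thesis
    using k False by simp
qed

text \<open>
  Integration by parts in the \<open>k\<close>-th angle: the average of the angular derivative of
  \<open>h w * mon (- \<alpha>) w\<close> vanishes, and the product rule splits it into the two sides.
\<close>

lemma coeff_at_partial:
  assumes S: "rot_invariant S" "z \<in> S" "S \<subseteq> off_axes"
    and cont: "continuous_on S h" "continuous_on S h'"
    and der: "has_partial k h h' S"
  shows "coeff_at h' (\<alpha>(k := \<alpha> k - 1)) z = of_int (\<alpha> k) * coeff_at h \<alpha> z"
proof -
  let ?m = "mon (\<lambda>k. - \<alpha> k)"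
  have nz: "rot t z \<in> off_axes" for t
    using S by (auto simp: rot_invariant_def)
  have cm: "continuous_on S ?m"
    using continuous_on_subset[OF continuous_on_mon S(3)] .
  let ?D = "\<lambda>w. h' w * ?m w + h w * (of_int (- \<alpha> k) * ?m w / w $ k)"
  have "torus_avg (\<lambda>w. w $ k * ?D w) z = 0"
  proof (rule torus_avg_partial_eq_0[OF S(1,2)])
    show "continuous_on S (\<lambda>w. h w * ?m w)"
      using cont cm by (intro continuous_intros)
    show "continuous_on S ?D"
      using cont cm S(3) by (intro continuous_intros) (auto simp: off_axes_def)
    show "has_partial k (\<lambda>w. h w * ?m w) ?D S"
      by (rule has_partial_mult[OF der has_partial_subset[OF has_partial_mon S(3)]])
  qed
  moreover have "(\<lambda>j. - (\<alpha>(k := \<alpha> k - 1)) j) = (\<lambda>j. - \<alpha> j)(k := - \<alpha> k + 1)"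
    by auto
  then have "mon (\<lambda>j. - (\<alpha>(k := \<alpha> k - 1)) j) (rot t z) = rot t z $ k * ?m (rot t z)" for t
    using nz[of t] mon_Suc[of "rot t z" k "\<lambda>j. - \<alpha> j"] unfolding off_axes_def by auto
  then have "torus_avg (\<lambda>w. w $ k * ?D w) z =
      torus_avg (\<lambda>w. h' w * mon (\<lambda>j. - (\<alpha>(k := \<alpha> k - 1)) j) w - of_int (\<alpha> k) * (h w * ?m w)) z"
    unfolding torus_avg_def
    by (intro integral_cong) (use nz in \<open>auto simp: off_axes_def field_simps\<close>)
  moreover have "\<dots> = coeff_at h' (\<alpha>(k := \<alpha> k - 1)) z - of_int (\<alpha> k) * coeff_at h \<alpha> z"
    unfolding torus_avg_def coeff_at_def
  proof (subst integral_diff)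
    show "(\<lambda>t. h' (rot t z) * mon (\<lambda>j. - (\<alpha>(k := \<alpha> k - 1)) j) (rot t z)) integrable_on cbox 0 One"
      by (rule torus_avg_integrable[OF S(1) _ S(2)])
         (intro continuous_intros cont continuous_on_subset[OF continuous_on_mon S(3)])
    show "(\<lambda>t. of_int (\<alpha> k) * (h (rot t z) * ?m (rot t z))) integrable_on cbox 0 One"
      by (rule torus_avg_integrable[OF S(1) _ S(2)]) (intro continuous_intros cont cm)
  qed simp
  ultimately show ?thesis by simp
qed

section \<open>Independence of the Laurent coefficients from the base point\<close>

text \<open>
  Adding one and the same small nonzero number to all coordinates makes every coordinate nonzero.
\<close>

lemma off_axes_dense:
  fixes T :: "(complex ^ 'n) set"
  assumes "open T" "T \<noteq> {}"
  obtains z where "z \<in> T" "z \<in> off_axes"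
proof -
  obtain p where p: "p \<in> T" using assms by auto
  have "((\<lambda>\<eta>::complex. \<chi> k. p $ k + \<eta>) \<longlongrightarrow> (\<chi> k. p $ k + 0)) (at 0)"
    by (intro tendsto_vec_lambda tendsto_intros)
  then have "\<forall>\<^sub>F \<eta> in at 0. (\<chi> k. p $ k + \<eta>) \<in> T"
    using assms p by (auto intro: topological_tendstoD)
  moreover have "\<forall>\<^sub>F \<eta> in at 0. \<forall>k. \<eta> \<noteq> - p $ k"
    by (intro eventually_all_finite eventually_neq_at_within)
  ultimately have "\<forall>\<^sub>F \<eta> in at (0::complex). (\<chi> k. p $ k + \<eta>) \<in> T \<inter> off_axes"
    by eventually_elim (auto simp: off_axes_def add_eq_0_iff)
  then obtain \<eta> :: complex where "(\<chi> k. p $ k + \<eta>) \<in> T \<inter> off_axes"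
    using eventually_happens'[OF at_neq_bot] by blast
  then show ?thesis using that by blast
qed

lemma open_off_axes: "open (off_axes :: (complex ^ 'n) set)"
proof -
  have "off_axes = {z :: complex ^ 'n. \<forall>k. z $ k \<in> - {0}}"
    by (auto simp: off_axes_def)
  then show ?thesis
    using open_vector_box[of "\<lambda>k::'n. - {0::complex}"] by (simp add: open_Compl)
qed

text \<open>
  The coordinates of \<open>z\<close> are replaced by those of \<open>z'\<close> one at a time; in each step the point moves inside
  a connected planar set on which the derivative vanishes.
\<close>

lemma zero_partials_imp_constant_on_box:
  fixes a :: "complex ^ 'n \<Rightarrow> complex"
  assumes der: "\<And>w k. (\<forall>k. w $ k \<in> D k) \<Longrightarrow>
      ((\<lambda>\<zeta>. a (w + axis k \<zeta>)) has_field_derivative 0) (at 0)"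
    and D: "\<And>k. connected (D k)" "\<And>k. open (D k)"
    and z: "\<And>k. z $ k \<in> D k" and z': "\<And>k. z' $ k \<in> D k"
  shows "a z = a z'"
proof -
  have "a (\<chi> k. if k \<in> A then z' $ k else z $ k) = a z" if "finite A" for A
    using that
  proof (induction A)
    case empty
    then show ?case by (simp add: vec_lambda_eta)
  next
    case (insert k A)
    define w where "w u = (\<chi> i. if i = k then u else if i \<in> A then z' $ i else z $ i)" for u
    have w_shift: "w u = w v + axis k (u - v)" for u v
      by (simp add: w_def vec_eq_iff axis_def)
    have "((\<lambda>u. a (w u)) has_field_derivative 0) (at v)" if v: "v \<in> D k" for v
    proof -
      have "((\<lambda>\<zeta>. a (w v + axis k \<zeta>)) has_field_derivative 0) (at (v - v))"
        using v z z' by (auto intro!: der simp: w_def)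
      then have "((\<lambda>\<zeta>. a (w v + axis k \<zeta>)) \<circ> (\<lambda>u. u - v) has_field_derivative 0 * 1) (at v)"
        by (intro DERIV_chain) (auto intro!: derivative_eq_intros)
      then show ?thesis
        by (simp add: o_def flip: w_shift)
    qed
    then have "(\<lambda>u. a (w u)) constant_on D k"
      using D by (intro has_field_derivative_0_imp_constant_on)
    then have "a (w (z' $ k)) = a (w (z $ k))"
      using z z' by (auto simp: constant_on_def)
    moreover have "w (z' $ k) = (\<chi> i. if i \<in> insert k A then z' $ i else z $ i)"
      by (auto simp: w_def vec_eq_iff)
    moreover have "w (z $ k) = (\<chi> i. if i \<in> A then z' $ i else z $ i)"
      using insert.hyps by (auto simp: w_def vec_eq_iff)
    ultimately show ?case
      using insert.IH by simp
  qed
  from this[of UNIV] show ?thesis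
    by (simp add: vec_lambda_eta)
qed

text \<open>
  The set \<open>S \<inter> off_axes\<close> is connected because every point of \<open>S\<close>, also one on a coordinate hyperplane,
  has a product of discs around it in which the part off the hyperplanes is a product of connected
  sets, namely of discs and punctured discs. Constancy is propagated along \<open>S\<close> through these
  neighbourhoods.
\<close>

lemma zero_partials_imp_constant:
  fixes a :: "complex ^ 'n \<Rightarrow> complex"
  assumes S: "connected S" "open S"
    and der: "\<And>w k. w \<in> S \<inter> off_axes \<Longrightarrow> ((\<lambda>\<zeta>. a (w + axis k \<zeta>)) has_field_derivative 0) (at 0)"
    and z: "z \<in> S \<inter> off_axes" and z': "z' \<in> S \<inter> off_axes"
  shows "a z = a z'"
proof -
  have "a z' = a z"
  proof (rule connected_induction[OF S(1), where P = "\<lambda>w. w \<in> off_axes" and Q = "\<lambda>w. a w = a z"])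
    fix T p assume T: "openin (top_of_set S) T" "p \<in> T"
    then have "open T" "T \<noteq> {}"
      using openin_open_eq[OF S(2)] by auto
    then show "\<exists>w. w \<in> T \<and> w \<in> off_axes"
      by (rule off_axes_dense) blast
  next
    fix p assume p: "p \<in> S"
    then obtain A where A: "\<And>k. open (A k)" "\<And>k. p $ k \<in> A k" "\<And>y. (\<forall>k. y $ k \<in> A k) \<Longrightarrow> y \<in> S"
      using S(2)[unfolded open_vec_def, rule_format, OF p] by blast
    have "\<exists>e. e > 0 \<and> ball (p $ k) e \<subseteq> A k" for k
      using A(1,2) open_contains_ball by blast
    then obtain e where e: "\<And>k. e k > 0" "\<And>k. ball (p $ k) (e k) \<subseteq> A k"
      by metis
    define B where "B = {y. \<forall>k. y $ k \<in> ball (p $ k) (e k)}"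
    have "B \<subseteq> S"
      using e(2) A(3) unfolding B_def by blast
    have "open B"
      unfolding B_def by (rule open_vector_box) auto
    have "a x = a y" if "x \<in> B" "y \<in> B" "x \<in> off_axes" "y \<in> off_axes" for x y
    proof (rule zero_partials_imp_constant_on_box)
      fix w :: "complex ^ 'n" and k assume "\<forall>k. w $ k \<in> ball (p $ k) (e k) - {0}"
      then have "w \<in> S \<inter> off_axes"
        using \<open>B \<subseteq> S\<close> by (auto simp: B_def off_axes_def)
      then show "((\<lambda>\<zeta>. a (w + axis k \<zeta>)) has_field_derivative 0) (at 0)"
        by (rule der)
    next
      show "connected (ball (p $ k) (e k) - {0})" for k
        by (rule connected_open_delete) auto
    qed (use that in \<open>auto simp: B_def off_axes_def\<close>)
    then have "\<forall>x\<in>B. \<forall>y\<in>B. x \<in> off_axes \<and> y \<in> off_axes \<and> a x = a z \<longrightarrow> a y = a z"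
      by metis
    moreover have "openin (top_of_set S) B" "p \<in> B"
      using \<open>open B\<close> \<open>B \<subseteq> S\<close> e by (auto simp: B_def openin_open_eq S(2))
    ultimately show "\<exists>T. openin (top_of_set S) T \<and> p \<in> T \<and>
        (\<forall>x\<in>T. \<forall>y\<in>T. x \<in> off_axes \<and> y \<in> off_axes \<and> a x = a z \<longrightarrow> a y = a z)"
      by blast
  qed (use z z' in auto)
  then show ?thesis by simp
qed

lemma coeff_at_constant:
  assumes S: "connected S" "open S" "rot_invariant S"
    and cont: "continuous_on S h" "\<And>k. continuous_on S (h' k)"
    and der: "\<And>k. has_partial k h (h' k) S"
    and z: "z \<in> S \<inter> off_axes" and z': "z' \<in> S \<inter> off_axes"
  shows "coeff_at h \<alpha> z = coeff_at h \<alpha> z'"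
proof (rule zero_partials_imp_constant[OF S(1,2) _ z z'])
  fix w k assume w: "w \<in> S \<inter> off_axes"
  let ?m = "mon (\<lambda>k. - \<alpha> k)"
  have sub: "continuous_on (S \<inter> off_axes) h" "continuous_on (S \<inter> off_axes) (h' k)"
      "continuous_on (S \<inter> off_axes) ?m"
    by (rule continuous_on_subset[OF cont(1)] continuous_on_subset[OF cont(2)]
      continuous_on_subset[OF continuous_on_mon], blast)+
  show "((\<lambda>\<zeta>. coeff_at h \<alpha> (w + axis k \<zeta>)) has_field_derivative 0) (at 0)"
    unfolding coeff_at_def
  proof (rule torus_avg_has_derivative_0[of "S \<inter> off_axes"])
    show "rot_invariant (S \<inter> off_axes)"
      using S(3) rot_invariant_off_axes by (auto simp: rot_invariant_def)
    show "open (S \<inter> off_axes)"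
      using S(2) open_off_axes by blast
    show "has_partial k (\<lambda>w. h w * ?m w)
            (\<lambda>z. h' k z * ?m z + h z * (of_int (- \<alpha> k) * ?m z / z $ k)) (S \<inter> off_axes)"
      by (rule has_partial_mult[OF has_partial_subset[OF der] has_partial_subset[OF has_partial_mon]]) auto
    show "continuous_on (S \<inter> off_axes) (\<lambda>w. h w * ?m w)"
      by (intro continuous_intros sub)
    show "continuous_on (S \<inter> off_axes) (\<lambda>z. h' k z * ?m z + h z * (of_int (- \<alpha> k) * ?m z / z $ k))"
      by (intro continuous_intros sub) (auto simp: off_axes_def)
  qed (use w in auto)
qed

section \<open>Iterated partial derivatives of holomorphic functions\<close>

text \<open>
  Partial derivatives are again holomorphic in each variable separately: Cauchy's formula in the
  \<open>k\<close>-th variable writes \<open>g' k\<close> as an integral of \<open>g\<close>, which can be differentiated in the \<open>j\<close>-th variable under the integral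
  sign. This replaces an appeal to the symmetry of second derivatives.
\<close>

lemma partial_has_derivative:
  fixes g :: "complex ^ 'n \<Rightarrow> complex"
  assumes S: "open S" "z \<in> S"
    and cont: "continuous_on S g" "continuous_on S (g' j)"
    and der: "has_partial j g (g' j) S" "has_partial k g (g' k) S"
  shows "\<exists>d. ((\<lambda>\<zeta>. g' k (z + axis j \<zeta>)) has_field_derivative d) (at 0)"
proof -
  obtain R where R: "R > 0" "ball z R \<subseteq> S"
    using S open_contains_ball by blast
  define r where "r = R / 2"
  have r: "r > 0" using R by (simp add: r_def)
  define c where "c x = circlepath 0 r x" for x
  define q where "q x = 2 * pi * \<i> * r * exp (2 * of_real pi * \<i> * of_real x) / (c x)^2" for x
  have c_eq: "c x = r * exp (2 * of_real pi * \<i> * of_real x)" for x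
    by (simp add: c_def circlepath)
  have norm_c: "norm (c x) = r" for x
    using r by (simp add: c_eq norm_mult)
  have in_S: "z + axis j \<zeta> + axis k u \<in> S" if "norm \<zeta> < r" "norm u \<le> r" for \<zeta> u
  proof -
    have "norm (axis j \<zeta> + axis k u :: complex ^ 'n) \<le> norm \<zeta> + norm u"
      by (metis norm_axis_complex norm_triangle_ineq)
    then have "norm (axis j \<zeta> + axis k u :: complex ^ 'n) < R"
      using that unfolding r_def by linarith
    then have "dist (z + (axis j \<zeta> + axis k u)) z < R"
      by (simp add: dist_norm)
    then show ?thesis
      using R(2) by (metis add.assoc dist_commute mem_ball subsetD)
  qed
  have cont_c: "continuous_on X c" for X
    unfolding c_eq[abs_def] by (intro continuous_intros)
  have shift: "((\<lambda>u. g (z + axis j \<zeta> + axis k u)) has_field_derivative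
      g' k (z + axis j \<zeta> + axis k v)) (at v)"
    if "norm \<zeta> < r" "norm v \<le> r" for \<zeta> v
  proof -
    define w where "w = z + axis j \<zeta> + axis k v"
    have "((\<lambda>u. g (w + axis k u)) has_field_derivative g' k w) (at (v - v))"
      using der(2) in_S[OF that] by (auto simp: has_partial_def w_def)
    then have "((\<lambda>u. g (w + axis k u)) \<circ> (\<lambda>u. u - v) has_field_derivative g' k w * 1) (at v)"
      by (intro DERIV_chain) (auto intro!: derivative_eq_intros)
    moreover have "z + axis j \<zeta> + axis k u = w + axis k (u - v)" for u
      by (simp add: w_def vec_eq_iff axis_def)
    ultimately show ?thesis
      by (simp add: o_def flip: w_def)
  qed
  have shift_j: "((\<lambda>\<xi>. g (z + axis j \<xi> + axis k v)) has_field_derivative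
      g' j (z + axis j \<zeta> + axis k v)) (at \<zeta>)"
    if "norm \<zeta> < r" "norm v \<le> r" for \<zeta> v
  proof -
    define w where "w = z + axis j \<zeta> + axis k v"
    have "((\<lambda>u. g (w + axis j u)) has_field_derivative g' j w) (at (\<zeta> - \<zeta>))"
      using der(1) in_S[OF that] by (auto simp: has_partial_def w_def)
    then have "((\<lambda>u. g (w + axis j u)) \<circ> (\<lambda>u. u - \<zeta>) has_field_derivative g' j w * 1) (at \<zeta>)"
      by (intro DERIV_chain) (auto intro!: derivative_eq_intros)
    moreover have "z + axis j u + axis k v = w + axis j (u - \<zeta>)" for u
      by (simp add: w_def vec_eq_iff axis_def)
    ultimately show ?thesis
      by (simp add: o_def flip: w_def)
  qed
  have Cauchy: "g' k (z + axis j \<zeta>) =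
      1 / (2 * of_real pi * \<i>) * integral (cbox 0 1) (\<lambda>x. g (z + axis j \<zeta> + axis k (c x)) * q x)"
    if \<zeta>: "norm \<zeta> < r" for \<zeta>
  proof -
    let ?\<phi> = "\<lambda>u. g (z + axis j \<zeta> + axis k u)"
    have "(?\<phi> has_field_derivative (1 / (2 * of_real pi * \<i>) *
            contour_integral (circlepath 0 r) (\<lambda>u. ?\<phi> u / (u - 0)^2))) (at 0)"
    proof (rule Cauchy_derivative_integral_circlepath(2))
      show "continuous_on (cball 0 r) ?\<phi>"
        using DERIV_isCont[OF shift[OF \<zeta>]] by (intro continuous_at_imp_continuous_on) simp
      show "?\<phi> holomorphic_on ball 0 r"
        unfolding holomorphic_on_open[OF open_ball] using shift[OF \<zeta>]
        by (metis mem_ball_0 less_imp_le)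
    qed (use r in auto)
    moreover have "(?\<phi> has_field_derivative g' k (z + axis j \<zeta> + axis k 0)) (at 0)"
      by (rule shift[OF \<zeta>]) (use r in auto)
    ultimately have "g' k (z + axis j \<zeta> + axis k 0) = 1 / (2 * of_real pi * \<i>) *
            contour_integral (circlepath 0 r) (\<lambda>u. ?\<phi> u / (u - 0)^2)"
      by (rule DERIV_unique[rotated])
    then show ?thesis
      by (simp add: contour_integral_integral q_def vector_derivative_circlepath flip: c_def)
  qed
  have "((\<lambda>\<zeta>. integral (cbox 0 1) (\<lambda>x. g (z + axis j \<zeta> + axis k (c x)) * q x)) has_field_derivative
          integral (cbox 0 1) (\<lambda>x. g' j (z + axis j 0 + axis k (c x)) * q x)) (at 0 within ball 0 r)"
  proof (rule leibniz_rule_field_derivative)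
    have cont_q: "continuous_on X (\<lambda>x. q (f x))" if "continuous_on X f" for f :: "'z::topological_space \<Rightarrow> real" and X
      unfolding q_def c_eq using that r by (intro continuous_intros) auto
    have cont_cf: "continuous_on X (\<lambda>x. c (f x))" if "continuous_on X f" for f :: "'z::topological_space \<Rightarrow> real" and X
      unfolding c_eq using that r by (intro continuous_intros) auto
    show "((\<lambda>\<zeta>. g (z + axis j \<zeta> + axis k (c x)) * q x) has_field_derivative
            g' j (z + axis j \<zeta> + axis k (c x)) * q x) (at \<zeta> within ball 0 r)"
      if "\<zeta> \<in> ball 0 r" for \<zeta> x
      using that by (intro has_field_derivative_at_within[OF DERIV_cmult_right] shift_j) (auto simp: norm_c)
    show "(\<lambda>x. g (z + axis j \<zeta> + axis k (c x)) * q x) integrable_on cbox 0 1"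
      if "\<zeta> \<in> ball 0 r" for \<zeta>
      by (intro integrable_continuous continuous_intros continuous_on_compose2[OF cont(1)] cont_q cont_cf)
         (use that in \<open>auto intro!: in_S simp: norm_c\<close>)
    show "continuous_on (ball 0 r \<times> cbox 0 1) (\<lambda>(\<zeta>, x). g' j (z + axis j \<zeta> + axis k (c x)) * q x)"
      unfolding split_def
      by (intro continuous_intros continuous_on_compose2[OF cont(2)] cont_q cont_cf)
         (auto intro!: in_S simp: norm_c)
  qed (use r in auto)
  then have "((\<lambda>\<zeta>. integral (cbox 0 1) (\<lambda>x. g (z + axis j \<zeta> + axis k (c x)) * q x)) has_field_derivative
          integral (cbox 0 1) (\<lambda>x. g' j (z + axis j 0 + axis k (c x)) * q x)) (at 0)"
    using r by (simp add: at_within_open[of _ "ball 0 r"])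
  then have "((\<lambda>\<zeta>. 1 / (2 * of_real pi * \<i>) * integral (cbox 0 1) (\<lambda>x. g (z + axis j \<zeta> + axis k (c x)) * q x))
      has_field_derivative 1 / (2 * of_real pi * \<i>) *
          integral (cbox 0 1) (\<lambda>x. g' j (z + axis j 0 + axis k (c x)) * q x)) (at 0)"
    by (rule DERIV_cmult)
  then have "((\<lambda>\<zeta>. g' k (z + axis j \<zeta>)) has_field_derivative 1 / (2 * of_real pi * \<i>) *
          integral (cbox 0 1) (\<lambda>x. g' j (z + axis j 0 + axis k (c x)) * q x)) (at 0)"
    by (rule has_field_derivative_transform_within_open[of _ _ _ "ball 0 r"]) (use r Cauchy in auto)
  then show ?thesis by blast
qed

lemma axis_of_real: "axis k (of_real t) = t *\<^sub>R (axis k 1 :: complex ^ 'n)"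
  by (simp add: vec_eq_iff axis_def of_real_def)

lemma partial_deriv_eq:
  assumes "((\<lambda>\<zeta>. g (z + axis k \<zeta>)) has_field_derivative d) (at 0)"
  shows "partial_deriv (axis k 1) g z = d"
proof -
  have "((\<lambda>t. g (z + axis k (of_real t))) has_vector_derivative d) (at 0)"
    using assms by (intro has_vector_derivative_real_field) auto
  then show ?thesis
    unfolding partial_deriv_def axis_of_real by (rule vector_derivative_at)
qed

lemma has_partial_holomorphic:
  assumes "holomorphic_several_on f S"
  shows "has_partial k f (partial_deriv (axis k 1) f) S"
  unfolding has_partial_def
proof
  fix z assume "z \<in> S"
  then obtain D where D: "(f has_derivative D) (at z)" "\<And>c v. D (c *s v) = c * D v"
    using assms unfolding holomorphic_several_on_def by blast
  have axis: "axis k \<zeta> = \<zeta> *s axis k 1" for \<zeta> :: complex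
    by (simp add: vec_eq_iff axis_def)
  have lin: "bounded_linear (\<lambda>\<zeta>::complex. axis k \<zeta> :: complex ^ 'a)"
    by (rule bounded_linear_intro[where K=1]) (simp add: vec_eq_iff axis_def, simp add: vec_eq_iff axis_def, simp add: norm_axis_complex)
  have "(f has_derivative D) (at (z + axis k 0))"
    using D by simp
  moreover have "((\<lambda>\<zeta>. z + axis k \<zeta>) has_derivative (\<lambda>\<zeta>. axis k \<zeta>)) (at 0)"
    using bounded_linear_imp_has_derivative[OF lin] by (auto intro!: derivative_eq_intros)
  ultimately have "(f \<circ> (\<lambda>\<zeta>. z + axis k \<zeta>) has_derivative D \<circ> (\<lambda>\<zeta>. axis k \<zeta>)) (at 0)"
    by (rule diff_chain_at[rotated])
  moreover have "D \<circ> (\<lambda>\<zeta>. axis k \<zeta>) = (*) (D (axis k 1))"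
    by (subst axis) (simp add: fun_eq_iff D(2) mult.commute)
  ultimately have "((\<lambda>\<zeta>. f (z + axis k \<zeta>)) has_field_derivative D (axis k 1)) (at 0)"
    by (simp add: has_field_derivative_def o_def)
  then show "((\<lambda>\<zeta>. f (z + axis k \<zeta>)) has_field_derivative partial_deriv (axis k 1) f z) (at 0)"
    using partial_deriv_eq by metis
qed

abbreviation iter_partial :: "'n list \<Rightarrow> (complex ^ 'n \<Rightarrow> complex) \<Rightarrow> complex ^ 'n \<Rightarrow> complex" where
  "iter_partial ks \<equiv> iterated_partial (map (\<lambda>k. axis k 1) ks)"

lemma axes_in_lists_Basis: "map (\<lambda>k. axis k 1 :: complex ^ 'n) ks \<in> lists Basis"
  by (auto simp: Basis_complex_def)

lemma continuous_iter_partial: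
  "smooth_on S f \<Longrightarrow> continuous_on S (iter_partial ks f)"
  using axes_in_lists_Basis unfolding smooth_on_def by blast

text \<open>
  Iterated derivatives in the real directions \<open>axis k 1\<close> are iterated complex derivatives. Smoothness
  supplies the continuity needed to repeat the previous step.
\<close>

lemma has_partial_iter_partial:
  assumes S: "open S" and smooth: "smooth_on S f" and hol: "holomorphic_several_on f S"
  shows "has_partial k (iter_partial ks f) (iter_partial (k # ks) f) S"
proof (induction ks arbitrary: k)
  case Nil
  then show ?case using has_partial_holomorphic[OF hol] by simp
next
  case (Cons j ks)
  show ?case
    unfolding has_partial_def
  proof
    fix z assume z: "z \<in> S"
    have "\<exists>d. ((\<lambda>\<zeta>. iter_partial (j # ks) f (z + axis k \<zeta>)) has_field_derivative d) (at 0)"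
      by (rule partial_has_derivative[OF S z, where g' = "\<lambda>i. iter_partial (i # ks) f"];
          rule continuous_iter_partial[OF smooth] Cons.IH)
    then show "((\<lambda>\<zeta>. iter_partial (j # ks) f (z + axis k \<zeta>)) has_field_derivative
        iter_partial (k # j # ks) f z) (at 0)"
      using partial_deriv_eq by (metis iterated_partial.simps(2) list.simps(9))
  qed
qed

section \<open>Vanishing of the coefficients with a negative exponent\<close>

lemma norm_torus_avg_le:
  assumes "\<And>t. norm (h (rot t z)) \<le> B"
  shows "norm (torus_avg h z) \<le> B"
proof (cases "(\<lambda>t. h (rot t z)) integrable_on cbox 0 One")
  case True
  have "0 \<le> B"
    using order_trans[OF norm_ge_zero assms] by blast
  then have "norm (torus_avg h z) \<le> B * measure lborel (cbox 0 (One :: real ^ 'a))"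
    unfolding torus_avg_def using assms integrable_integral[OF True]
    by (intro has_integral_bound) auto
  then show ?thesis by simp
next
  case False
  then show ?thesis
    using order_trans[OF norm_ge_zero assms] by (simp add: torus_avg_def not_integrable_integral)
qed

lemma norm_rot [simp]: "norm (rot t z) = norm z"
  by (simp add: norm_vec_def norm_mult)

lemma rot_0 [simp]: "rot 0 z = z"
  by (simp add: vec_eq_iff)

lemma rot_off_axes: "z \<in> off_axes \<Longrightarrow> rot t z \<in> off_axes"
  by (simp add: off_axes_def)

text \<open>
  Each differentiation in a variable with positive exponent lowers this exponent by one and multiplies
  the coefficient by the old, nonzero, exponent. Negative exponents are left alone.
\<close>

lemma coeff_at_iter_partial:
  fixes \<alpha> :: "'n::finite \<Rightarrow> int"
  assumes S: "open S" "rot_invariant S"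
    and f: "smooth_on S f" "holomorphic_several_on f S"
  shows "\<exists>ks c. c \<noteq> 0 \<and> (\<forall>z\<in>S \<inter> off_axes.
    coeff_at (iter_partial ks f) (\<lambda>k. min (\<alpha> k) 0) z = c * coeff_at f \<alpha> z)"
proof -
  have "\<exists>ks c. c \<noteq> 0 \<and> (\<forall>z\<in>S \<inter> off_axes.
    coeff_at (iter_partial ks f) (\<lambda>k. min (\<alpha> k) 0) z = c * coeff_at (iter_partial js f) \<alpha> z)"
    if "(\<Sum>k\<in>UNIV. nat (\<alpha> k)) = m" for m js and \<alpha> :: "'n::finite \<Rightarrow> int"
    using that
  proof (induction m arbitrary: \<alpha> js)
    case 0
    then have "(\<lambda>k. min (\<alpha> k) 0) = \<alpha>"
      by (auto simp: fun_eq_iff min_def)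
    then show ?case
      by (intro exI[of _ js] exI[of _ 1]) simp
  next
    case (Suc m)
    then obtain k where k: "\<alpha> k > 0"
      by (metis (no_types, lifting) nat_0_iff not_le nat.distinct(2) sum.neutral)
    let ?\<alpha> = "\<alpha>(k := \<alpha> k - 1)"
    have "(\<Sum>i\<in>UNIV. nat (\<alpha> i)) = Suc (\<Sum>i\<in>UNIV. nat (?\<alpha> i))"
      using k by (simp add: sum.remove[of UNIV k] Suc_nat_eq_nat_zadd1)
    then have "(\<Sum>i\<in>UNIV. nat (?\<alpha> i)) = m"
      using Suc.prems by simp
    from Suc.IH[OF this, of "k # js"] obtain ks c where c: "c \<noteq> 0"
      "\<And>z. z \<in> S \<inter> off_axes \<Longrightarrow> coeff_at (iter_partial ks f) (\<lambda>i. min (?\<alpha> i) 0) z =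
         c * coeff_at (iter_partial (k # js) f) ?\<alpha> z"
      by blast
    have "(\<lambda>i. min (?\<alpha> i) 0) = (\<lambda>i. min (\<alpha> i) 0)"
      using k by (auto simp: fun_eq_iff)
    moreover have "coeff_at (iter_partial (k # js) f) ?\<alpha> z = of_int (\<alpha> k) * coeff_at (iter_partial js f) \<alpha> z"
      if "z \<in> S \<inter> off_axes" for z
    proof (rule coeff_at_partial[of "S \<inter> off_axes"])
      show "rot_invariant (S \<inter> off_axes)"
        using S(2) rot_invariant_off_axes by (auto simp: rot_invariant_def)
      show "has_partial k (iter_partial js f) (iter_partial (k # js) f) (S \<inter> off_axes)"
        by (rule has_partial_subset[OF has_partial_iter_partial[OF S(1) f]]) simp
      show "continuous_on (S \<inter> off_axes) (iter_partial js f)"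
           "continuous_on (S \<inter> off_axes) (iter_partial (k # js) f)"
        by (rule continuous_on_subset[OF continuous_iter_partial[OF f(1)]], simp)+
    qed (use that in auto)
    ultimately have "\<forall>z\<in>S \<inter> off_axes. coeff_at (iter_partial ks f) (\<lambda>i. min (\<alpha> i) 0) z =
         (c * of_int (\<alpha> k)) * coeff_at (iter_partial js f) \<alpha> z"
      using c(2) by (simp add: mult.assoc)
    then show ?case
      using c(1) k by (intro exI[of _ ks] exI[of _ "c * of_int (\<alpha> k)"]) auto
  qed
  from this[OF refl, of \<alpha> "[]"] show ?thesis by simp
qed

lemma norm_mon_le_norm:
  fixes z :: "complex ^ 'n"
  assumes "norm z \<le> 1" "\<And>k. \<beta> k \<ge> 0" "\<beta> j > 0"
  shows "norm (mon \<beta> z) \<le> norm z"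
proof -
  have le1: "norm (z $ k) \<le> 1" for k
    using Finite_Cartesian_Product.norm_nth_le assms(1) by (rule order_trans)
  have "norm (mon \<beta> z) = norm (z $ j) ^ nat (\<beta> j) * (\<Prod>k\<in>-{j}. norm (z $ k) ^ nat (\<beta> k))"
    unfolding mon_split[where k = j] using assms(2)
    by (simp add: norm_mult prod_norm[symmetric] power_int_def norm_power)
  also have "\<dots> \<le> norm (z $ j) ^ nat (\<beta> j) * 1"
    by (intro mult_left_mono prod_le_1) (auto simp: le1 power_le_one)
  also have "\<dots> \<le> norm (z $ j) ^ 1"
    using assms(3) le1[of j] power_decreasing[of 1 "nat (\<beta> j)" "norm (z $ j)"] by simp
  also have "\<dots> \<le> norm z"
    using Finite_Cartesian_Product.norm_nth_le by simp
  finally show ?thesis .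
qed

lemma coeff_at_constant_holomorphic:
  assumes S: "connected S" "open S" "rot_invariant S"
    and f: "smooth_on S f" "holomorphic_several_on f S"
    and z: "z \<in> S \<inter> off_axes" and w: "w \<in> S \<inter> off_axes"
  shows "coeff_at f \<alpha> z = coeff_at f \<alpha> w"
proof (rule coeff_at_constant[OF S])
  show "continuous_on S f"
    using continuous_iter_partial[OF f(1), of "[]"] by simp
  show "continuous_on S (iter_partial [k] f)" for k
    by (rule continuous_iter_partial[OF f(1)])
  show "has_partial k f (iter_partial [k] f) S" for k
    using has_partial_iter_partial[OF S(2) f, of k "[]"] by simp
qed (use w z in auto)

text \<open>
  This is the only place where smoothness up to the boundary is used. Removing the positive part of the
  exponent by differentiation is essential: \<open>z\<close> approaches \<open>0\<close> in an uncontrolled way, and a positive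
  power of one coordinate in the denominator of the bound could undo the decay in another.
\<close>

lemma negative_coeff_eq_0:
  fixes \<alpha> :: "'n::finite \<Rightarrow> int"
  assumes S: "connected S" "open S" "rot_invariant S" "0 \<in> closure S"
    and f: "smooth_up_to_boundary S f" "holomorphic_several_on f S"
    and z: "z \<in> S \<inter> off_axes" and neg: "\<alpha> j < 0"
  shows "coeff_at f \<alpha> z = 0"
proof (rule ccontr)
  assume nz: "coeff_at f \<alpha> z \<noteq> 0"
  have smooth: "smooth_on S f"
    using f(1) by (simp add: smooth_up_to_boundary_def)
  define \<beta> where "\<beta> k = min (\<alpha> k) 0" for k
  obtain ks c where c: "c \<noteq> 0"
    "\<And>w. w \<in> S \<inter> off_axes \<Longrightarrow> coeff_at (iter_partial ks f) \<beta> w = c * coeff_at f \<alpha> w"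
    using coeff_at_iter_partial[OF S(2,3) smooth f(2), of \<alpha>] unfolding \<beta>_def by blast
  obtain g where g: "continuous_on (closure S) g" "\<And>w. w \<in> S \<Longrightarrow> g w = iter_partial ks f w"
    using f(1) axes_in_lists_Basis[of ks] unfolding smooth_up_to_boundary_def by blast
  obtain d where d: "d > 0" "\<And>w. w \<in> closure S \<Longrightarrow> dist w 0 < d \<Longrightarrow> dist (g w) (g 0) < 1"
    using g(1) S(4) unfolding continuous_on_iff by (metis zero_less_one)
  define C where "C = norm (g 0) + 1"
  have C: "C > 0" by (simp add: C_def add_nonneg_pos)
  have bound: "norm (iter_partial ks f w) \<le> C" if "w \<in> S" "norm w < d" for w
  proof -
    have "dist (g w) (g 0) < 1"
      using that d(2) closure_subset by auto
    then have "norm (g w) \<le> C"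
      using norm_triangle_ineq2[of "g w" "g 0"] unfolding C_def dist_norm by linarith
    then show ?thesis
      using g(2) that by simp
  qed
  define e where "e = min (min d 1) (norm (c * coeff_at f \<alpha> z) / C)"
  have e: "e > 0"
    using d(1) C c(1) nz by (simp add: e_def)
  have "S \<inter> ball 0 e \<noteq> {}"
  proof -
    obtain y where "y \<in> S" "dist y 0 < e"
      using S(4) e unfolding closure_approachable by blast
    then have "y \<in> S \<inter> ball 0 e"
      by simp
    then show ?thesis by blast
  qed
  then obtain w where w: "w \<in> S" "norm w < e" "w \<in> off_axes"
    using off_axes_dense[of "S \<inter> ball 0 e"] S(2) by (metis Int_iff open_Int open_ball mem_ball_0)
  have "coeff_at f \<alpha> w = coeff_at f \<alpha> z"
    by (rule coeff_at_constant_holomorphic[OF S(1-3) smooth f(2)]) (use w z in auto)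
  then have "norm (c * coeff_at f \<alpha> z) = norm (coeff_at (iter_partial ks f) \<beta> w)"
    using c(2)[of w] w by simp
  also have "\<dots> \<le> C * norm w"
    unfolding coeff_at_def
  proof (rule norm_torus_avg_le)
    fix t
    have "norm (iter_partial ks f (rot t w)) \<le> C"
      using S(3) w by (intro bound) (auto simp: rot_invariant_def e_def)
    moreover have "norm (mon (\<lambda>k. - \<beta> k) w) \<le> norm w"
      using w neg by (intro norm_mon_le_norm[where j = j]) (auto simp: \<beta>_def e_def)
    ultimately show "norm (iter_partial ks f (rot t w) * mon (\<lambda>k. - \<beta> k) (rot t w)) \<le> C * norm w"
      unfolding norm_mult norm_mon_rot using C by (intro mult_mono) auto
  qed
  also have "\<dots> < C * e"
    using w C by simp
  also have "\<dots> \<le> norm (c * coeff_at f \<alpha> z)"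
    using C by (simp add: e_def min_def field_simps)
  finally show False by simp
qed

section \<open>Uniqueness of Fourier coefficients on a torus orbit\<close>

lemma torus_avg_add:
  assumes "(\<lambda>t. g (rot t z)) integrable_on cbox 0 One" "(\<lambda>t. h (rot t z)) integrable_on cbox 0 One"
  shows "torus_avg (\<lambda>w. g w + h w) z = torus_avg g z + torus_avg h z"
  unfolding torus_avg_def using assms by (rule integral_add)

lemma torus_avg_cmult: "torus_avg (\<lambda>w. c * h w) z = c * torus_avg h z"
  by (simp add: torus_avg_def)

lemma torus_avg_cong:
  "(\<And>t. g (rot t z) = h (rot t z)) \<Longrightarrow> torus_avg g z = torus_avg h z"
  by (simp add: torus_avg_def)

text \<open>
  By periodicity, angles in the unit cube suffice.
\<close>

lemma compact_orbit: "compact (range (\<lambda>t. rot t (z :: complex ^ 'n)))"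
proof -
  have "range (\<lambda>t. rot t z) = (\<lambda>t. rot t z) ` cbox 0 One"
  proof -
    have "rot t z \<in> (\<lambda>t. rot t z) ` cbox 0 One" for t
    proof
      show "rot t z = rot (\<chi> k. frac (t $ k)) z"
      proof -
        have "cis (2 * pi * frac x) = cis (2 * pi * x)" for x
        proof -
          have "cis (2 * pi * x) = cis (2 * pi * frac x + 2 * pi * of_int \<lfloor>x\<rfloor>)"
            by (simp add: frac_def algebra_simps)
          then show ?thesis
            by (simp add: cis_multiple_2pi flip: cis_mult)
        qed
        then show ?thesis by (simp add: vec_eq_iff)
      qed
      show "(\<chi> k. frac (t $ k)) \<in> cbox 0 One"
        unfolding mem_box
      proof
        fix b :: "real ^ 'n" assume b: "b \<in> Basis"
        then obtain k where "b = axis k 1"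
          by (auto simp: Basis_vec_def)
        then show "0 \<bullet> b \<le> (\<chi> k. frac (t $ k)) \<bullet> b \<and> (\<chi> k. frac (t $ k)) \<bullet> b \<le> One \<bullet> b"
          using inner_One_Basis[OF b] by (simp add: inner_axis frac_lt_1 less_imp_le)
      qed
    qed
    then show ?thesis by auto
  qed
  moreover have "compact ((\<lambda>t. rot t z) ` cbox 0 One)"
    by (intro compact_continuous_image continuous_intros compact_cbox)
  ultimately show ?thesis by simp
qed

text \<open>
  By the Stone-Weierstrass theorem, the conjugate of \<open>h\<close> is uniformly approximated on the orbit by
  polynomials in the real and imaginary parts of the coordinates. There the conjugate of a coordinate is
  a multiple of its inverse, so such polynomials are combinations of Laurent monomials and \<open>h\<close> is
  orthogonal to them. Hence the average of \<open>\<bar>h\<bar>\<^sup>2\<close> is zero.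
\<close>

lemma fourier_uniqueness:
  fixes h :: "complex ^ 'n \<Rightarrow> complex"
  assumes z: "z \<in> off_axes" and cont: "continuous_on (range (\<lambda>t. rot t z)) h"
    and zero: "\<And>\<alpha>. torus_avg (\<lambda>w. h w * mon \<alpha> w) z = 0"
  shows "h z = 0"
proof -
  define K where "K = range (\<lambda>t. rot t z)"
  have K: "compact K"
    unfolding K_def by (rule compact_orbit)
  have off: "rot t z \<in> off_axes" for t
    using z by (rule rot_off_axes)
  have rot_K: "rot t z \<in> K" for t
    by (auto simp: K_def)
  have int: "(\<lambda>t. q (rot t z)) integrable_on cbox 0 One" if "continuous_on K q" for q :: "complex ^ 'n \<Rightarrow> complex"
    by (rule integrable_continuous, rule continuous_on_compose2[OF that])
       (auto intro!: continuous_intros simp: rot_K)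
  have K_off: "K \<subseteq> off_axes"
    using off by (auto simp: K_def)
  have cont_mon: "continuous_on K (mon \<alpha>)" for \<alpha>
    using continuous_on_subset[OF continuous_on_mon K_off] .
  \<comment> \<open>It is enough to know which multipliers preserve vanishing of all Fourier coefficients: these form an algebra, and no normal form for trigonometric polynomials is needed.\<close>
  define null where "null q \<longleftrightarrow> (\<forall>\<alpha>. torus_avg (\<lambda>w. q w * mon \<alpha> w) z = 0)" for q
  define good where "good p \<longleftrightarrow> continuous_on K p \<and>
     (\<forall>q. continuous_on K q \<longrightarrow> null q \<longrightarrow> null (\<lambda>w. q w * p w))" for p
  have good_const: "good (\<lambda>w. c)" for c
  proof -
    have "torus_avg (\<lambda>w. q w * c * mon \<alpha> w) z = c * torus_avg (\<lambda>w. q w * mon \<alpha> w) z" for q \<alpha>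
      unfolding torus_avg_cmult[symmetric] by (simp add: mult_ac)
    then show ?thesis
      unfolding good_def null_def by auto
  qed
  have good_add: "good (\<lambda>w. p w + p' w)" if "good p" "good p'" for p p'
  proof -
    have cont: "continuous_on K p" "continuous_on K p'"
      using that by (auto simp: good_def)
    have "torus_avg (\<lambda>w. q w * (p w + p' w) * mon \<alpha> w) z =
        torus_avg (\<lambda>w. q w * p w * mon \<alpha> w) z + torus_avg (\<lambda>w. q w * p' w * mon \<alpha> w) z"
      if "continuous_on K q" for q \<alpha>
      unfolding distrib_left distrib_right
      by (rule torus_avg_add; rule int; intro continuous_intros that cont cont_mon)
    then show ?thesis
      using that unfolding good_def null_def by (auto intro!: continuous_intros)
  qed
  have good_mult: "good (\<lambda>w. p w * p' w)" if "good p" "good p'" for p p'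
  proof -
    have "null (\<lambda>w. q w * p w * p' w)" if "continuous_on K q" "null q" for q
      using \<open>good p\<close> \<open>good p'\<close> that unfolding good_def by (auto intro!: continuous_intros)
    then show ?thesis
      using that unfolding good_def by (auto intro!: continuous_intros simp: mult.assoc)
  qed
  have good_coord: "good (\<lambda>w. w $ k)" for k
  proof -
    have "torus_avg (\<lambda>w. q w * w $ k * mon \<alpha> w) z = torus_avg (\<lambda>w. q w * mon (\<alpha>(k := \<alpha> k + 1)) w) z" for q \<alpha>
      using off by (intro torus_avg_cong) (simp add: mon_Suc off_axes_def)
    then show ?thesis
      unfolding good_def null_def by (auto intro!: continuous_intros)
  qed
  have good_cnj: "good (\<lambda>w. cnj (w $ k))" for k
  proof -
    have "torus_avg (\<lambda>w. q w * cnj (w $ k) * mon \<alpha> w) z =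
        torus_avg (\<lambda>w. of_real (norm (z $ k))^2 * (q w * mon (\<alpha>(k := \<alpha> k - 1)) w)) z" for q \<alpha>
    proof (rule torus_avg_cong)
      fix t
      define w where "w = rot t z"
      have wk: "w $ k \<noteq> 0"
        using off[of t] by (simp add: w_def off_axes_def)
      have "mon \<alpha> w = w $ k * mon (\<alpha>(k := \<alpha> k - 1)) w"
        using mon_Suc[OF wk, of "\<alpha>(k := \<alpha> k - 1)"] by simp
      moreover have "norm (z $ k) = norm (w $ k)"
        by (simp add: w_def norm_mult)
      then have "of_real (norm (z $ k))^2 = w $ k * cnj (w $ k)"
        by (metis complex_norm_square of_real_power)
      ultimately show "q w * cnj (w $ k) * mon \<alpha> w =
          of_real (norm (z $ k))^2 * (q w * mon (\<alpha>(k := \<alpha> k - 1)) w)"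
        by (simp add: mult_ac)
    qed
    then show ?thesis
      unfolding good_def null_def torus_avg_cmult by (auto intro!: continuous_intros)
  qed
  have good_sum: "good (\<lambda>w. \<Sum>k\<in>I. p k w)" if "finite I" "\<And>k. k \<in> I \<Longrightarrow> good (p k)"
    for I :: "'n set" and p
    using that by (induction I) (auto intro: good_const good_add)
  have good_linear: "good (\<lambda>w. of_real (p w))" if p: "bounded_linear p" for p :: "complex ^ 'n \<Rightarrow> real"
  proof -
    have "of_real (p w) = (\<Sum>k\<in>UNIV. of_real (p (axis k 1)) * (1/2 * (w $ k + cnj (w $ k)))
           + of_real (p (axis k \<i>)) * (1 / (2 * \<i>) * (w $ k + (-1) * cnj (w $ k))))" for w
    proof -
      interpret bounded_linear p by fact
      have "w = (\<Sum>k\<in>UNIV. Re (w $ k) *\<^sub>R axis k 1 + Im (w $ k) *\<^sub>R axis k \<i>)"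
        by (simp add: vec_eq_iff axis_def complex_eq_iff sum.distrib if_distrib[of "(*) _"] if_distrib[of Re] if_distrib[of Im] cong: if_cong)
      then have "p w = p (\<Sum>k\<in>UNIV. Re (w $ k) *\<^sub>R axis k 1 + Im (w $ k) *\<^sub>R axis k \<i>)"
        by simp
      also have "\<dots> = (\<Sum>k\<in>UNIV. Re (w $ k) * p (axis k 1) + Im (w $ k) * p (axis k \<i>))"
        by (simp add: sum add scaleR)
      finally have "complex_of_real (p w) =
          (\<Sum>k\<in>UNIV. of_real (Re (w $ k) * p (axis k 1) + Im (w $ k) * p (axis k \<i>)))"
        by simp
      also have "\<dots> = (\<Sum>k\<in>UNIV. of_real (p (axis k 1)) * (1/2 * (w $ k + cnj (w $ k)))
           + of_real (p (axis k \<i>)) * (1 / (2 * \<i>) * (w $ k + (-1) * cnj (w $ k))))"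
        by (intro sum.cong) (auto simp: complex_eq_iff)
      finally show ?thesis .
    qed
    then have eq: "(\<lambda>w. of_real (p w)) = (\<lambda>w. \<Sum>k\<in>UNIV. of_real (p (axis k 1)) * (1/2 * (w $ k + cnj (w $ k)))
           + of_real (p (axis k \<i>)) * (1 / (2 * \<i>) * (w $ k + (-1) * cnj (w $ k))))"
      by (rule ext)
    show ?thesis
      unfolding eq by (intro good_sum good_add good_mult good_const good_coord good_cnj finite)
  qed
  have good_real_poly: "good (\<lambda>w. of_real (p w))" if "real_polynomial_function p" for p :: "complex ^ 'n \<Rightarrow> real"
    using that by (induction p) (auto intro: good_linear good_const good_add good_mult)
  have good_poly: "good p" if "polynomial_function p" for p :: "complex ^ 'n \<Rightarrow> complex"
  proof -
    have "real_polynomial_function (Re \<circ> p)" "real_polynomial_function (Im \<circ> p)"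
      using that bounded_linear_Re bounded_linear_Im unfolding polynomial_function_def by blast+
    then have "good (\<lambda>w. of_real ((Re \<circ> p) w) + \<i> * of_real ((Im \<circ> p) w))"
      by (intro good_add good_mult good_const good_real_poly)
    then show ?thesis
      by (simp flip: complex_eq)
  qed
  have contK: "continuous_on K h"
    using cont by (simp add: K_def)
  obtain B where B: "B > 0" "\<And>w. w \<in> K \<Longrightarrow> norm (h w) \<le> B"
    using compact_imp_bounded[OF compact_continuous_image[OF contK K]] unfolding bounded_pos by auto
  have "norm (torus_avg (\<lambda>w. h w * cnj (h w)) z) \<le> 0 + e" if e: "e > 0" for e
  proof -
    have "continuous_on K (\<lambda>w. cnj (h w))"
      using contK by (intro continuous_intros)
    then obtain p where p: "polynomial_function p" "\<And>w. w \<in> K \<Longrightarrow> norm (cnj (h w) - p w) < e / B"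
      using Stone_Weierstrass_polynomial_function[OF K, of "\<lambda>w. cnj (h w)" "e / B"] e B by auto
    have gp: "good p" by (rule good_poly[OF p(1)])
    then have contp: "continuous_on K p" by (simp add: good_def)
    have "null (\<lambda>w. h w * p w)"
      using gp contK zero unfolding good_def null_def by blast
    then have "torus_avg (\<lambda>w. h w * p w * mon (\<lambda>k. 0) w) z = 0"
      unfolding null_def by blast
    moreover have "torus_avg (\<lambda>w. h w * cnj (h w)) z =
        torus_avg (\<lambda>w. h w * (cnj (h w) - p w) + h w * p w) z"
      by (rule torus_avg_cong) (simp add: algebra_simps)
    moreover have "\<dots> = torus_avg (\<lambda>w. h w * (cnj (h w) - p w)) z + torus_avg (\<lambda>w. h w * p w) z"
      by (rule torus_avg_add; rule int; intro continuous_intros contK contp)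
    moreover have "norm (torus_avg (\<lambda>w. h w * (cnj (h w) - p w)) z) \<le> B * (e / B)"
    proof (rule norm_torus_avg_le)
      show "norm (h (rot t z) * (cnj (h (rot t z)) - p (rot t z))) \<le> B * (e / B)" for t
        unfolding norm_mult
        by (rule mult_mono[OF B(2)[OF rot_K] less_imp_le[OF p(2)[OF rot_K]] less_imp_le[OF B(1)] norm_ge_zero])
    qed
    ultimately show ?thesis
      using B by simp
  qed
  then have "torus_avg (\<lambda>w. h w * cnj (h w)) z = 0"
    using field_le_epsilon[of "norm (torus_avg (\<lambda>w. h w * cnj (h w)) z)" 0] by simp
  moreover have "(\<lambda>t. h (rot t z) * cnj (h (rot t z))) integrable_on cbox 0 One"
    by (rule int[where q = "\<lambda>w. h w * cnj (h w)"]) (intro continuous_intros contK)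
  ultimately have "((\<lambda>t. h (rot t z) * cnj (h (rot t z))) has_integral 0) (cbox 0 One)"
    unfolding has_integral_iff torus_avg_def by (rule conjI[rotated])
  from has_integral_linear[OF this bounded_linear_Re]
  have "((\<lambda>t. (norm (h (rot t z)))\<^sup>2) has_integral 0) (cbox 0 One)"
    unfolding cmod_power2 by (simp add: o_def power2_eq_square)
  then have "(norm (h (rot 0 z)))\<^sup>2 = 0"
  proof (rule has_integral_0_cbox_imp_0[rotated 2])
    show "continuous_on (cbox 0 One) (\<lambda>t. (norm (h (rot t z)))\<^sup>2)"
      by (intro continuous_intros continuous_on_compose2[OF contK]) (auto simp: rot_K)
    show "box 0 (One :: real ^ 'n) \<noteq> {}" "(0 :: real ^ 'n) \<in> cbox 0 One"
      by (auto simp: box_ne_empty mem_box inner_One_Basis)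
  qed auto
  then show ?thesis by simp
qed

section \<open>The Cauchy integral over a torus orbit\<close>

definition polydisc :: "complex ^ 'n \<Rightarrow> (complex ^ 'n) set" where
  "polydisc r = {w. \<forall>k. norm (w $ k) < norm (r $ k)}"

text \<open>
  The extra factors \<open>\<zeta> $ k\<close> come from writing \<open>d\<zeta> / (2 * pi * \<i>)\<close> on a circle in terms of the
  normalised angle.
\<close>

definition cauchy_kernel :: "complex ^ 'n \<Rightarrow> complex ^ 'n \<Rightarrow> complex" where
  "cauchy_kernel \<zeta> w = (\<Prod>k\<in>UNIV. \<zeta> $ k / (\<zeta> $ k - w $ k))"

definition cauchy_extension :: "complex ^ 'n \<Rightarrow> (complex ^ 'n \<Rightarrow> complex) \<Rightarrow> complex ^ 'n \<Rightarrow> complex" where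
  "cauchy_extension r f w = torus_avg (\<lambda>\<zeta>. f \<zeta> * cauchy_kernel \<zeta> w) r"

definition taylor_partial_sum ::
    "complex ^ 'n \<Rightarrow> (complex ^ 'n \<Rightarrow> complex) \<Rightarrow> nat \<Rightarrow> complex ^ 'n \<Rightarrow> complex" where
  "taylor_partial_sum r f N w =
     (\<Sum>\<alpha>\<in>PiE UNIV (\<lambda>_. {..N}). coeff_at f (\<lambda>k. int (\<alpha> k)) r * mon (\<lambda>k. int (\<alpha> k)) w)"

lemma open_polydisc: "open (polydisc r)"
proof -
  have "polydisc r = {w. \<forall>k. w $ k \<in> ball (0::complex) (norm (r $ k))}"
    by (auto simp: polydisc_def)
  then show ?thesis
    using open_vector_box[of "\<lambda>k. ball (0::complex) (norm (r $ k))"] by simp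
qed

lemma convex_polydisc: "convex (polydisc r)"
proof -
  have "convex ((\<lambda>w. w $ k) -` ball (0::complex) (norm (r $ k)))" for k
    by (intro convex_linear_vimage bounded_linear.linear[OF bounded_linear_vec_nth] convex_ball)
  moreover have "polydisc r = (\<Inter>k. (\<lambda>w. w $ k) -` ball (0::complex) (norm (r $ k)))"
    by (auto simp: polydisc_def)
  ultimately show ?thesis
    by (simp add: convex_INT)
qed

text \<open>
  Differentiation under the integral sign. The derivative of the kernel is complex linear, and this
  survives integration.
\<close>

lemma cauchy_extension_holomorphic:
  fixes r :: "complex ^ 'n"
  assumes cont: "continuous_on (range (\<lambda>t. rot t r)) f"
  shows "holomorphic_several_on (cauchy_extension r f) (polydisc r)"
proof -
  define D where "D w t v = f (rot t r) * (\<Sum>i\<in>UNIV.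
      rot t r $ i / (rot t r $ i - w $ i)^2 * v $ i *
        (\<Prod>j\<in>UNIV - {i}. rot t r $ j / (rot t r $ j - w $ j)))" for w v and t :: "real ^ 'n"
  have ne: "rot t r $ k \<noteq> w $ k" if "w \<in> polydisc r" for w t k
  proof
    assume "rot t r $ k = w $ k"
    then have "norm (rot t r $ k) = norm (w $ k)"
      by (simp only:)
    moreover have "norm (w $ k) < norm (r $ k)"
      using that by (simp add: polydisc_def)
    ultimately show False
      by (simp add: norm_mult)
  qed
  have bl: "bounded_linear (D w t)" for w t
    unfolding D_def
    by (intro bounded_linear_const_mult bounded_linear_sum bounded_linear_mult_const bounded_linear_vec_nth)
  have contf: "continuous_on X (\<lambda>x. f (rot (g x) r))" if "continuous_on X g"
    for X :: "'z::topological_space set" and g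
    by (rule continuous_on_compose2[OF cont]) (use that in \<open>auto intro!: continuous_intros\<close>)
  have der: "((\<lambda>w. f (rot t r) * cauchy_kernel (rot t r) w) has_derivative D w t) (at w within X)"
    if w: "w \<in> polydisc r" for w t X
  proof -
    have "((\<lambda>w. rot t r $ k / (rot t r $ k - w $ k)) has_derivative
           (\<lambda>v. rot t r $ k / (rot t r $ k - w $ k)^2 * v $ k)) (at w within X)" for k
    proof -
      have nth: "((\<lambda>w. w $ k) has_derivative (\<lambda>v. v $ k)) (at w within X)"
        by (rule bounded_linear_imp_has_derivative[OF bounded_linear_vec_nth])
      have "((\<lambda>u. rot t r $ k / (rot t r $ k - u)) has_field_derivative
             rot t r $ k / (rot t r $ k - w $ k)^2) (at (w $ k))"
        using ne[OF w, of t k] by (auto intro!: derivative_eq_intros simp: power2_eq_square)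
      then have "((\<lambda>u. rot t r $ k / (rot t r $ k - u)) has_derivative
             (\<lambda>v. rot t r $ k / (rot t r $ k - w $ k)^2 * v)) (at (w $ k))"
        unfolding has_field_derivative_def .
      from has_derivative_compose[OF nth this] show ?thesis .
    qed
    then show ?thesis
      unfolding cauchy_kernel_def D_def by (intro has_derivative_mult_right has_derivative_prod)
  qed
  have contD: "continuous_on (polydisc r \<times> cbox 0 One) (\<lambda>(w, t). D w t v)" for v
    unfolding D_def split_def rot_nth cis_conv_exp
    by (intro continuous_intros contf) (use ne in \<open>auto simp: cis_conv_exp\<close>)
  have contB: "continuous_on (polydisc r \<times> cbox 0 One) (\<lambda>(w, t). Blinfun (D w t))"
    using contD by (intro continuous_on_blinfun_componentwise)
      (simp add: split_def bounded_linear_Blinfun_apply[OF bl])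
  show ?thesis
    unfolding holomorphic_several_on_def
  proof
    fix w assume w: "w \<in> polydisc r"
    have "((\<lambda>w. integral (cbox 0 One) (\<lambda>t. f (rot t r) * cauchy_kernel (rot t r) w)) has_derivative
             blinfun_apply (integral (cbox 0 One) (\<lambda>t. Blinfun (D w t)))) (at w within polydisc r)"
    proof (rule leibniz_rule)
      show "((\<lambda>w. f (rot t r) * cauchy_kernel (rot t r) w) has_derivative blinfun_apply (Blinfun (D w t)))
          (at w within polydisc r)" if "w \<in> polydisc r" for w t
        unfolding bounded_linear_Blinfun_apply[OF bl] by (rule der[OF that])
      show "(\<lambda>t. f (rot t r) * cauchy_kernel (rot t r) w) integrable_on cbox 0 One"
        if "w \<in> polydisc r" for w
        unfolding cauchy_kernel_def rot_nth cis_conv_exp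
        by (intro integrable_continuous continuous_intros contf)
           (use ne[OF that] in \<open>auto simp: cis_conv_exp\<close>)
    qed (use w contB convex_polydisc in auto)
    then have "(cauchy_extension r f has_derivative
             blinfun_apply (integral (cbox 0 One) (\<lambda>t. Blinfun (D w t)))) (at w)"
      unfolding cauchy_extension_def[abs_def] torus_avg_def
      by (simp add: at_within_open[OF w open_polydisc])
    moreover have "blinfun_apply (integral (cbox 0 One) (\<lambda>t. Blinfun (D w t))) (c *s v) =
        c * blinfun_apply (integral (cbox 0 One) (\<lambda>t. Blinfun (D w t))) v" for c v
    proof -
      have "continuous_on (cbox 0 One) (\<lambda>t. Blinfun (D w t))"
      proof -
        have "continuous_on (cbox 0 One) (\<lambda>t. (\<lambda>(w, t). Blinfun (D w t)) (w, t))"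
          by (rule continuous_on_compose2[OF contB]) (use w in \<open>auto intro!: continuous_intros\<close>)
        then show ?thesis by simp
      qed
      then have int: "(\<lambda>t. Blinfun (D w t)) integrable_on cbox 0 One"
        by (rule integrable_continuous)
      have "D w t (c *s v) = c * D w t v" for t
        by (simp add: D_def sum_distrib_left mult_ac)
      then show ?thesis
        by (simp add: blinfun_apply_integral[OF int] bounded_linear_Blinfun_apply[OF bl])
    qed
    ultimately show "\<exists>D. (cauchy_extension r f has_derivative D) (at w) \<and> (\<forall>c v. D (c *s v) = c * D v)"
      by blast
  qed
qed

text \<open>
  After scaling every factor by \<open>1 - \<rho>\<close>, all factors have norm at most \<open>1\<close>, so the difference of the
  products is at most the sum of the differences of the factors, which are tails of geometric series.
\<close>

lemma geometric_kernel_bound: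
  fixes q :: "'n::finite \<Rightarrow> complex"
  assumes q: "\<And>k. norm (q k) \<le> \<rho>" and \<rho>: "0 \<le> \<rho>" "\<rho> < 1"
  shows "norm ((\<Prod>k\<in>UNIV. 1 / (1 - q k)) - (\<Prod>k\<in>UNIV. \<Sum>m\<le>N. q k ^ m))
           \<le> real CARD('n) * \<rho> ^ Suc N / (1 - \<rho>) ^ CARD('n)"
proof -
  let ?c = "of_real (1 - \<rho>) :: complex"
  have lower: "norm (1 - q k) \<ge> 1 - \<rho>" for k
    using q[of k] norm_triangle_ineq2[of 1 "q k"] by simp
  then have ne: "q k \<noteq> 1" for k
    using \<rho> by (metis cancel_comm_monoid_add_class.diff_cancel diff_gt_0_iff_gt norm_zero not_le)
  have geo: "1 / (1 - q k) - (\<Sum>m\<le>N. q k ^ m) = q k ^ Suc N / (1 - q k)" for k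
    using ne[of k] sum_gp0[of "q k" N] by (simp add: field_simps)
  have norm_c: "norm ?c = 1 - \<rho>"
    unfolding norm_of_real using \<rho> by simp
  have 1: "norm (?c * (1 / (1 - q k))) \<le> 1" for k
    using lower[of k] \<rho> ne[of k] by (simp add: norm_mult norm_divide norm_c divide_le_eq del: of_real_diff)
  have 2: "norm (?c * (\<Sum>m\<le>N. q k ^ m)) \<le> 1" for k
  proof -
    have "norm (\<Sum>m\<le>N. q k ^ m) \<le> (\<Sum>m\<le>N. \<rho> ^ m)"
      by (rule sum_norm_le) (simp add: norm_power power_mono q)
    also have "\<dots> = (1 - \<rho> ^ Suc N) / (1 - \<rho>)"
      using sum_gp0[of \<rho> N] \<rho> by simp
    also have "\<dots> \<le> 1 / (1 - \<rho>)"
      using \<rho> by (intro divide_right_mono) auto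
    finally show ?thesis
      using \<rho> by (simp add: norm_mult field_simps del: of_real_diff)
  qed
  have 3: "norm (?c * (1 / (1 - q k)) - ?c * (\<Sum>m\<le>N. q k ^ m)) \<le> \<rho> ^ Suc N" for k
  proof -
    have "?c * (1 / (1 - q k)) - ?c * (\<Sum>m\<le>N. q k ^ m) = ?c * (1 / (1 - q k)) * q k ^ Suc N"
      unfolding right_diff_distrib[symmetric] geo by simp
    also have "norm \<dots> \<le> 1 * \<rho> ^ Suc N"
      unfolding norm_mult[of _ "q k ^ Suc N"] norm_power
      by (intro mult_mono 1 power_mono q) auto
    finally show ?thesis by simp
  qed
  have "(1 - \<rho>) ^ CARD('n) * norm ((\<Prod>k\<in>UNIV. 1 / (1 - q k)) - (\<Prod>k\<in>UNIV. \<Sum>m\<le>N. q k ^ m))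
     = norm (?c ^ CARD('n) * ((\<Prod>k\<in>UNIV. 1 / (1 - q k)) - (\<Prod>k\<in>UNIV. \<Sum>m\<le>N. q k ^ m)))"
    using \<rho> by (simp add: norm_mult norm_power del: of_real_diff)
  also have "\<dots> = norm ((\<Prod>k\<in>UNIV. ?c * (1 / (1 - q k))) - (\<Prod>k\<in>UNIV. ?c * (\<Sum>m\<le>N. q k ^ m)))"
    unfolding prod.distrib prod_constant by (simp add: right_diff_distrib)
  also have "\<dots> \<le> (\<Sum>k\<in>(UNIV::'n set). norm (?c * (1 / (1 - q k)) - ?c * (\<Sum>m\<le>N. q k ^ m)))"
    by (rule norm_prod_diff) (use 1 2 in auto)
  also have "\<dots> \<le> (\<Sum>k\<in>(UNIV::'n set). \<rho> ^ Suc N)"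
    by (rule sum_mono) (rule 3)
  finally show ?thesis
    using \<rho> by (simp add: pos_le_divide_eq mult.commute)
qed

text \<open>
  The partial sum is the Cauchy integral with the kernel replaced by the product of truncated geometric
  series; summing over exponents in a cube, rather than by total degree, makes this product available.
\<close>

lemma taylor_partial_sum_bound:
  fixes r :: "complex ^ 'n"
  assumes r: "r \<in> off_axes" and cont: "continuous_on (range (\<lambda>t. rot t r)) f"
    and B: "\<And>t. norm (f (rot t r)) \<le> B"
    and w: "\<And>k. norm (w $ k) \<le> \<rho> * norm (r $ k)" and \<rho>: "0 \<le> \<rho>" "\<rho> < 1"
  shows "norm (cauchy_extension r f w - taylor_partial_sum r f N w)
           \<le> B * (real CARD('n) * \<rho> ^ Suc N / (1 - \<rho>) ^ CARD('n))"
proof -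
  have off: "rot t r \<in> off_axes" for t
    using r by (rule rot_off_axes)
  have rk: "rot t r $ k \<noteq> 0" for t k
    using off[of t] unfolding off_axes_def by blast
  have contf: "continuous_on (cbox 0 One) (\<lambda>t. f (rot t r))"
    by (rule continuous_on_compose2[OF cont]) (auto intro!: continuous_intros)
  have cont_rot: "continuous_on (cbox 0 One) (\<lambda>t. rot t r $ k)" for k
    by (intro continuous_intros)
  define G where "G \<zeta> = (\<Prod>k\<in>UNIV. \<Sum>m\<le>N. (w $ k / \<zeta> $ k) ^ m)" for \<zeta>
  have q: "norm (w $ k / rot t r $ k) \<le> \<rho>" for t k
    using w[of k] rk[of t k] by (simp add: norm_divide norm_mult divide_le_eq)
  have kernel: "cauchy_kernel (rot t r) w = (\<Prod>k\<in>UNIV. 1 / (1 - w $ k / rot t r $ k))" for t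
    unfolding cauchy_kernel_def using rk[of t] by (intro prod.cong) (auto simp: divide_simps)
  have ne: "rot t r $ k - w $ k \<noteq> 0" for t k
  proof
    assume "rot t r $ k - w $ k = 0"
    then have "w $ k / rot t r $ k = 1"
      using rk[of t k] by simp
    then show False
      using q[of k t] \<rho> by simp
  qed
  have G: "G \<zeta> = (\<Sum>\<alpha>\<in>PiE UNIV (\<lambda>_. {..N}). mon (\<lambda>k. int (\<alpha> k)) w * mon (\<lambda>k. - int (\<alpha> k)) \<zeta>)" for \<zeta>
    unfolding G_def by (subst prod_sum_PiE) (auto simp: mon_def power_divide power_int_minus divide_inverse
       power_mult_distrib power_inverse simp flip: prod.distrib)
  have cont_mon: "continuous_on (cbox 0 One) (\<lambda>t. mon \<alpha> (rot t r))" for \<alpha>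
    by (rule continuous_on_compose2[OF continuous_on_mon]) (auto intro!: continuous_intros simp: off)
  have "taylor_partial_sum r f N w = torus_avg (\<lambda>\<zeta>. f \<zeta> * G \<zeta>) r"
  proof -
    have "torus_avg (\<lambda>\<zeta>. f \<zeta> * G \<zeta>) r = integral (cbox 0 One) (\<lambda>t. \<Sum>\<alpha>\<in>PiE UNIV (\<lambda>_. {..N}).
        f (rot t r) * mon (\<lambda>k. - int (\<alpha> k)) (rot t r) * mon (\<lambda>k. int (\<alpha> k)) w)"
      unfolding torus_avg_def G sum_distrib_left by (simp add: mult_ac)
    also have "\<dots> = (\<Sum>\<alpha>\<in>PiE UNIV (\<lambda>_. {..N}). integral (cbox 0 One)
        (\<lambda>t. f (rot t r) * mon (\<lambda>k. - int (\<alpha> k)) (rot t r) * mon (\<lambda>k. int (\<alpha> k)) w))"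
      by (intro integral_sum finite_PiE integrable_continuous continuous_intros contf cont_mon) auto
    finally show ?thesis
      by (simp add: taylor_partial_sum_def coeff_at_def torus_avg_def)
  qed
  moreover have "cauchy_extension r f w - torus_avg (\<lambda>\<zeta>. f \<zeta> * G \<zeta>) r =
      torus_avg (\<lambda>\<zeta>. f \<zeta> * (cauchy_kernel \<zeta> w - G \<zeta>)) r"
    unfolding cauchy_extension_def torus_avg_def right_diff_distrib
  proof (rule integral_diff[symmetric])
    show "(\<lambda>t. f (rot t r) * cauchy_kernel (rot t r) w) integrable_on cbox 0 One"
      unfolding cauchy_kernel_def using ne
      by (intro integrable_continuous continuous_intros contf cont_rot) auto
    show "(\<lambda>t. f (rot t r) * G (rot t r)) integrable_on cbox 0 One"
      unfolding G by (intro integrable_continuous continuous_intros contf cont_mon)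
  qed
  moreover have "norm (torus_avg (\<lambda>\<zeta>. f \<zeta> * (cauchy_kernel \<zeta> w - G \<zeta>)) r)
      \<le> B * (real CARD('n) * \<rho> ^ Suc N / (1 - \<rho>) ^ CARD('n))"
  proof (rule norm_torus_avg_le)
    fix t
    have "0 \<le> B"
      using order_trans[OF norm_ge_zero B] .
    then show "norm (f (rot t r) * (cauchy_kernel (rot t r) w - G (rot t r)))
      \<le> B * (real CARD('n) * \<rho> ^ Suc N / (1 - \<rho>) ^ CARD('n))"
      unfolding norm_mult kernel G_def
      by (intro mult_mono B geometric_kernel_bound q \<rho>) auto
  qed
  ultimately show ?thesis by simp
qed

section \<open>The extension\<close>

lemma continuous_on_holomorphic_several: "holomorphic_several_on f S \<Longrightarrow> continuous_on S f"
  unfolding holomorphic_several_on_def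
  by (intro continuous_at_imp_continuous_on ballI) (metis has_derivative_continuous)

text \<open>
  Averaging against the monomial of exponent \<open>\<alpha>\<close> picks out the coefficient of exponent \<open>- \<alpha>\<close>. Once
  \<open>N \<ge> \<bar>\<alpha> k\<bar>\<close> for all \<open>k\<close>, this coefficient is the same for \<open>f\<close> and its Taylor partial sum: if \<open>- \<alpha>\<close> is
  nonnegative, by orthogonality of monomials, and otherwise because both are zero. The
  partial sums converge to the Cauchy integral uniformly on the orbit of \<open>z\<close>, so all Fourier coefficients
  of the difference vanish.
\<close>

lemma cauchy_extension_eq_off_axes:
  fixes r :: "complex ^ 'n"
  assumes S: "connected S" "open S" "rot_invariant S" "0 \<in> closure S"
    and f: "smooth_up_to_boundary S f" "holomorphic_several_on f S"
    and r: "r \<in> S \<inter> off_axes" and z: "z \<in> S \<inter> polydisc r" "z \<in> off_axes"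
  shows "cauchy_extension r f z = f z"
proof -
  let ?F = "cauchy_extension r f" and ?n = "real CARD('n)"
  have smooth: "smooth_on S f"
    using f(1) by (simp add: smooth_up_to_boundary_def)
  have contf: "continuous_on S f"
    by (rule continuous_on_holomorphic_several[OF f(2)])
  have orbit: "range (\<lambda>t. rot t w) \<subseteq> S" if "w \<in> S" for w
    using S(3) that by (auto simp: rot_invariant_def)
  have cont_r: "continuous_on (range (\<lambda>t. rot t r)) f" and cont_z: "continuous_on (range (\<lambda>t. rot t z)) f"
    using orbit r z by (auto intro!: continuous_on_subset[OF contf])
  have rot_P: "rot t z \<in> polydisc r" for t
    using z by (simp add: polydisc_def norm_mult)
  have contF: "continuous_on (range (\<lambda>t. rot t z)) ?F"
    by (rule continuous_on_subset[OF continuous_on_holomorphic_several[OF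
          cauchy_extension_holomorphic[OF cont_r]]]) (auto simp: rot_P)
  have off: "rot t z \<in> off_axes" for t
    using z(2) by (rule rot_off_axes)
  have int: "(\<lambda>t. q (rot t z)) integrable_on cbox 0 One"
    if "continuous_on (range (\<lambda>t. rot t z)) q" for q :: "complex ^ 'n \<Rightarrow> complex"
    by (rule integrable_continuous, rule continuous_on_compose2[OF that]) (auto intro!: continuous_intros)
  have cont_mon: "continuous_on (range (\<lambda>t. rot t z)) (mon \<alpha>)" for \<alpha>
    by (rule continuous_on_subset[OF continuous_on_mon]) (auto simp: off)
  obtain B where B: "\<And>t. norm (f (rot t r)) \<le> B"
    using compact_imp_bounded[OF compact_continuous_image[OF cont_r compact_orbit]]
    unfolding bounded_iff by auto
  \<comment> \<open>The orbit of \<open>z\<close> lies in a compact part of the polydisc, where the partial sums converge geometrically.\<close>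
  define \<rho> where "\<rho> = Max (range (\<lambda>k. norm (z $ k) / norm (r $ k)))"
  have rk: "r $ k \<noteq> 0" for k
    using r by (simp add: off_axes_def)
  have le_\<rho>: "norm (z $ k) / norm (r $ k) \<le> \<rho>" for k
    unfolding \<rho>_def by (rule Max_ge) auto
  have \<rho>0: "0 \<le> \<rho>"
    using order_trans[OF _ le_\<rho>] by (metis divide_nonneg_nonneg norm_ge_zero)
  have \<rho>1: "\<rho> < 1"
    unfolding \<rho>_def using z(1) rk by (subst Max_less_iff) (auto simp: polydisc_def)
  have z_le: "norm (rot t z $ k) \<le> \<rho> * norm (r $ k)" for t k
    using le_\<rho>[of k] rk[of k] by (simp add: norm_mult pos_divide_le_eq)
  have "torus_avg (\<lambda>w. (f w - ?F w) * mon \<alpha> w) z = 0" for \<alpha>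
  proof -
    define C where "C = B * (?n * \<rho> / (1 - \<rho>) ^ CARD('n)) * norm (mon \<alpha> z)"
    have bound: "norm (torus_avg (\<lambda>w. (f w - ?F w) * mon \<alpha> w) z) \<le> C * \<rho> ^ N"
      if N: "N \<ge> Max (range (\<lambda>k. nat \<bar>\<alpha> k\<bar>))" for N
    proof -
      let ?T = "taylor_partial_sum r f N"
      have contT: "continuous_on (range (\<lambda>t. rot t z)) ?T"
        unfolding taylor_partial_sum_def by (intro continuous_intros cont_mon)
      have N': "nat \<bar>\<alpha> k\<bar> \<le> N" for k
        using N by (subst (asm) Max_le_iff) auto
      have "torus_avg (\<lambda>w. ?T w * mon \<alpha> w) z = coeff_at f (\<lambda>k. - \<alpha> k) r"
      proof -
        let ?A = "PiE UNIV (\<lambda>_. {..N}) :: ('n \<Rightarrow> nat) set"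
        have "torus_avg (\<lambda>w. ?T w * mon \<alpha> w) z = torus_avg (\<lambda>w. \<Sum>\<beta>\<in>?A.
            coeff_at f (\<lambda>k. int (\<beta> k)) r * mon (\<lambda>k. int (\<beta> k) + \<alpha> k) w) z"
          by (rule torus_avg_cong)
             (simp add: taylor_partial_sum_def sum_distrib_right mult.assoc mon_mult[OF off])
        also have "\<dots> = (\<Sum>\<beta>\<in>?A. torus_avg (\<lambda>w.
            coeff_at f (\<lambda>k. int (\<beta> k)) r * mon (\<lambda>k. int (\<beta> k) + \<alpha> k) w) z)"
          unfolding torus_avg_def
          by (intro integral_sum finite_PiE int continuous_intros cont_mon) auto
        also have "\<dots> = (\<Sum>\<beta>\<in>?A. if (\<lambda>k. int (\<beta> k)) = (\<lambda>k. - \<alpha> k)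
            then coeff_at f (\<lambda>k. - \<alpha> k) r else 0)"
        proof (rule sum.cong[OF refl])
          fix \<beta> :: "'n \<Rightarrow> nat"
          have "(\<lambda>k. int (\<beta> k) + \<alpha> k) = (\<lambda>k. 0) \<longleftrightarrow> (\<lambda>k. int (\<beta> k)) = (\<lambda>k. - \<alpha> k)"
            by (auto simp: fun_eq_iff eq_neg_iff_add_eq_0)
          then show "torus_avg (\<lambda>w. coeff_at f (\<lambda>k. int (\<beta> k)) r * mon (\<lambda>k. int (\<beta> k) + \<alpha> k) w) z =
              (if (\<lambda>k. int (\<beta> k)) = (\<lambda>k. - \<alpha> k) then coeff_at f (\<lambda>k. - \<alpha> k) r else 0)"
            by (simp add: torus_avg_cmult torus_avg_mon[OF z(2)])
        qed
        also have "\<dots> = coeff_at f (\<lambda>k. - \<alpha> k) r"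
        proof (cases "\<exists>j. - \<alpha> j < 0")
          case True
          then obtain j where "- \<alpha> j < 0" by blast
          then have "coeff_at f (\<lambda>k. - \<alpha> k) r = 0"
            by (rule negative_coeff_eq_0[OF S f r])
          then show ?thesis by (simp cong: if_cong)
        next
          case False
          define \<gamma> where "\<gamma> k = nat (- \<alpha> k)" for k
          have "\<gamma> \<in> ?A"
            using N' False by (auto simp: \<gamma>_def) (metis abs_le_iff nat_mono order_trans order_refl)
          moreover have "(\<lambda>k. int (\<beta> k)) = (\<lambda>k. - \<alpha> k) \<longleftrightarrow> \<beta> = \<gamma>" for \<beta>
            using False by (auto simp: \<gamma>_def fun_eq_iff not_less) (metis nat_int)+
          ultimately show ?thesis
            by (simp add: sum.delta finite_PiE)
        qed
        finally show ?thesis .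
      qed
      also have "\<dots> = coeff_at f (\<lambda>k. - \<alpha> k) z"
        by (rule coeff_at_constant_holomorphic[OF S(1-3) smooth f(2)]) (use r z in auto)
      also have "\<dots> = torus_avg (\<lambda>w. f w * mon \<alpha> w) z"
        by (simp add: coeff_at_def)
      finally have "torus_avg (\<lambda>w. (f w - ?F w) * mon \<alpha> w) z =
          torus_avg (\<lambda>w. (f w - ?F w) * mon \<alpha> w) z +
          (torus_avg (\<lambda>w. ?T w * mon \<alpha> w) z + (-1) * torus_avg (\<lambda>w. f w * mon \<alpha> w) z)"
        by simp
      also have "\<dots> = torus_avg (\<lambda>w. (f w - ?F w) * mon \<alpha> w +
          (?T w * mon \<alpha> w + (-1) * (f w * mon \<alpha> w))) z"
        unfolding torus_avg_cmult[symmetric]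
        by (subst torus_avg_add torus_avg_add; (intro int continuous_intros contT contF cont_z cont_mon)?)+ simp
      also have "\<dots> = torus_avg (\<lambda>w. (?T w - ?F w) * mon \<alpha> w) z"
        by (rule torus_avg_cong) (simp add: algebra_simps)
      also have "norm \<dots> \<le> C * \<rho> ^ N"
      proof (rule norm_torus_avg_le)
        fix t
        have "norm (?F (rot t z) - ?T (rot t z)) \<le> B * (?n * \<rho> ^ Suc N / (1 - \<rho>) ^ CARD('n))"
          using r by (intro taylor_partial_sum_bound cont_r B z_le \<rho>0 \<rho>1) auto
        then have "norm ((?T (rot t z) - ?F (rot t z)) * mon \<alpha> (rot t z)) \<le>
            B * (?n * \<rho> ^ Suc N / (1 - \<rho>) ^ CARD('n)) * norm (mon \<alpha> z)"
          unfolding norm_mult norm_mon_rot by (intro mult_right_mono) (auto simp: norm_minus_commute)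
        then show "norm ((?T (rot t z) - ?F (rot t z)) * mon \<alpha> (rot t z)) \<le> C * \<rho> ^ N"
          by (simp add: C_def mult_ac)
      qed
      finally show ?thesis .
    qed
    have "(\<lambda>N. C * \<rho> ^ N) \<longlonglongrightarrow> C * 0"
      using \<rho>0 \<rho>1 by (intro tendsto_mult tendsto_const LIMSEQ_realpow_zero) auto
    then have "norm (torus_avg (\<lambda>w. (f w - ?F w) * mon \<alpha> w) z) \<le> C * 0"
    proof (rule LIMSEQ_le_const)
      show "\<exists>M. \<forall>N\<ge>M. norm (torus_avg (\<lambda>w. (f w - ?F w) * mon \<alpha> w) z) \<le> C * \<rho> ^ N"
        by (intro exI allI impI) (rule bound)
    qed
    then show ?thesis by simp
  qed
  then have "f z - ?F z = 0"
    by (rule fourier_uniqueness[OF z(2) continuous_on_diff[OF cont_z contF]])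
  then show ?thesis by simp
qed

text \<open>
  Both sides are continuous and points off the coordinate hyperplanes are dense.
\<close>

lemma cauchy_extension_eq:
  fixes r :: "complex ^ 'n"
  assumes S: "connected S" "open S" "rot_invariant S" "0 \<in> closure S"
    and f: "smooth_up_to_boundary S f" "holomorphic_several_on f S"
    and r: "r \<in> S \<inter> off_axes" and z: "z \<in> S \<inter> polydisc r"
  shows "cauchy_extension r f z = f z"
proof (rule ccontr)
  let ?F = "cauchy_extension r f"
  assume ne: "?F z \<noteq> f z"
  have contf: "continuous_on S f"
    by (rule continuous_on_holomorphic_several[OF f(2)])
  have "range (\<lambda>t. rot t r) \<subseteq> S"
    using S(3) r by (auto simp: rot_invariant_def)
  then have "continuous_on (polydisc r) ?F"
    by (intro continuous_on_holomorphic_several cauchy_extension_holomorphic continuous_on_subset[OF contf])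
  then have "continuous_on (S \<inter> polydisc r) (\<lambda>w. ?F w - f w)"
    by (intro continuous_intros) (auto intro: continuous_on_subset contf)
  then have "open ((S \<inter> polydisc r) \<inter> (\<lambda>w. ?F w - f w) -` (- {0}))"
    using S(2) open_polydisc by (intro continuous_open_preimage) auto
  moreover have "z \<in> (S \<inter> polydisc r) \<inter> (\<lambda>w. ?F w - f w) -` (- {0})"
    using z ne by simp
  ultimately obtain w where "w \<in> (S \<inter> polydisc r) \<inter> (\<lambda>w. ?F w - f w) -` (- {0})" "w \<in> off_axes"
    using off_axes_dense by blast
  then show False
    using cauchy_extension_eq_off_axes[OF S f r, of w] by simp
qed

lemma holomorphic_several_on_glue:
  assumes f: "holomorphic_several_on f S" "open S" and g: "holomorphic_several_on g U" "open U"
    and eq: "\<And>z. z \<in> S \<inter> U \<Longrightarrow> g z = f z"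
  shows "holomorphic_several_on (\<lambda>z. if z \<in> S then f z else g z) (S \<union> U)"
  unfolding holomorphic_several_on_def
proof
  fix z assume "z \<in> S \<union> U"
  then consider "z \<in> S" | "z \<in> U" by blast
  then show "\<exists>D. ((\<lambda>z. if z \<in> S then f z else g z) has_derivative D) (at z) \<and> (\<forall>c v. D (c *s v) = c * D v)"
  proof cases
    case 1
    then obtain D where D: "(f has_derivative D) (at z)" "\<forall>c v. D (c *s v) = c * D v"
      using f(1) unfolding holomorphic_several_on_def by blast
    have "((\<lambda>z. if z \<in> S then f z else g z) has_derivative D) (at z)"
      by (rule has_derivative_transform_within_open[OF D(1) f(2) 1]) simp
    then show ?thesis using D(2) by blast
  next
    case 2
    then obtain D where D: "(g has_derivative D) (at z)" "\<forall>c v. D (c *s v) = c * D v"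
      using g(1) unfolding holomorphic_several_on_def by blast
    have "((\<lambda>z. if z \<in> S then f z else g z) has_derivative D) (at z)"
      by (rule has_derivative_transform_within_open[OF D(1) g(2) 2]) (simp add: eq)
    then show ?thesis using D(2) by blast
  qed
qed

lemma Reinhardt_domain_rot_invariant: "Reinhardt_domain S \<Longrightarrow> rot_invariant S"
  unfolding Reinhardt_domain_def rot_invariant_def
proof (intro ballI allI)
  fix z t
  assume S: "complex_domain S \<and> (\<forall>z\<in>S. \<forall>\<theta>. (\<chi> i. exp (\<i> * complex_of_real (\<theta> i)) * z $ i) \<in> S)"
    and z: "z \<in> S"
  show "rot t z \<in> S"
    using bspec[OF conjunct2[OF S] z, THEN spec, of "\<lambda>k. 2 * pi * t $ k"]
    by (simp add: rot_def cis_conv_exp)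
qed

theorem mainTheorem1:
  fixes \<Omega> :: "(complex ^ 'n) set"
  assumes "Reinhardt_domain \<Omega>"
    and "0 \<in> frontier \<Omega>"
  shows "\<exists>U. open U \<and> 0 \<in> U \<and>
    (\<forall>f. smooth_up_to_boundary \<Omega> f \<and> holomorphic_several_on f \<Omega> \<longrightarrow>
      (\<exists>F. holomorphic_several_on F (\<Omega> \<union> U) \<and> (\<forall>z\<in>\<Omega>. F z = f z)))"
proof -
  have S: "connected \<Omega>" "open \<Omega>" "\<Omega> \<noteq> {}" "rot_invariant \<Omega>" "0 \<in> closure \<Omega>"
    using assms Reinhardt_domain_rot_invariant
    by (auto simp: Reinhardt_domain_def complex_domain_def frontier_def)
  obtain r where r: "r \<in> \<Omega> \<inter> off_axes"
    using off_axes_dense[OF S(2,3)] by blast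
  have "\<exists>F. holomorphic_several_on F (\<Omega> \<union> polydisc r) \<and> (\<forall>z\<in>\<Omega>. F z = f z)"
    if f: "smooth_up_to_boundary \<Omega> f" "holomorphic_several_on f \<Omega>" for f
  proof (intro exI conjI ballI)
    have "range (\<lambda>t. rot t r) \<subseteq> \<Omega>"
      using S(4) r by (auto simp: rot_invariant_def)
    then have "holomorphic_several_on (cauchy_extension r f) (polydisc r)"
      by (intro cauchy_extension_holomorphic
          continuous_on_subset[OF continuous_on_holomorphic_several[OF f(2)]])
    then show "holomorphic_several_on (\<lambda>z. if z \<in> \<Omega> then f z else cauchy_extension r f z) (\<Omega> \<union> polydisc r)"
      using cauchy_extension_eq[OF S(1,2,4,5) f r]
      by (intro holomorphic_several_on_glue f(2) S(2) open_polydisc) auto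
  qed simp
  moreover have "0 \<in> polydisc r"
    using r by (simp add: polydisc_def off_axes_def)
  ultimately show ?thesis
    using open_polydisc by blast
qed

end
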